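(* (a) If $w$ is a word of length $\ell$, then $w$ is not $d$-slantable for any integer $d\geq 8\log_2\ell+47$. (b) If $\ell>1$ is an integer all of whose prime factors are at least $2^d$, then the word $\mathsf{A}\mathsf{B}^{\ell-1}$ (one letter $\mathsf A$ followed by $\ell-1$ copies of a distinct letter $\mathsf B$) is $d$-slantable.
   Context: A word is a finite string $w=w_0w_1\cdots w_{\ell-1}$ of letters; words are assumed to contain at least two distinct letters. A $d$-dimensional grid $\Gamma$ of shape $G=\prod_{i=1}^d\mathbb Z/n_i\mathbb Z$ is a map $\Gamma\colon G\to\Sigma$ to an alphabet; its size is $|G|$. An appearance of $w$ in $\Gamma$ is a pair $(p,\mathbf v)\in G\times(\{-1,0,1\}^d\setminus\{\mathbf 0\})$ with $\Gamma(p+i\mathbf v)=w_i$ for all $0\le i<\ell$. The concentration $c_d(w,\Gamma)$ is the number of appearances divided by $|G|$, and $C_d(w)$ is the supremum of $c_d(w,\Gamma)$ over all $d$-dimensional grids. A word $w$ is called $d$-slantable if $C_d(w)=\frac{3^d-1}{2}C_1(w)$. *)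

theory Defs
  imports Complex_Main "HOL-Library.FuncSet" "HOL-Computational_Algebra.Primes"
begin

definition is_word :: "'a list \<Rightarrow> bool" where
  "is_word w \<longleftrightarrow> card (set w) \<ge> 2"

text \<open>
  The group \<open>\<Prod>k<d. \<int>/n k\<int>\<close>, coordinates being indexed by \<open>{..<d}\<close> and each residue class
  represented by its canonical representative in \<open>{0..<n k}\<close>.
\<close>

definition grid_points :: "nat \<Rightarrow> (nat \<Rightarrow> nat) \<Rightarrow> (nat \<Rightarrow> int) set" where
  "grid_points d n = (\<Pi>\<^sub>E k\<in>{..<d}. {0..<int (n k)})"

text \<open>
  Directions are integer vectors, not elements of the group: two of them that agree modulo
  the \<open>n k\<close> still count as different.
\<close>

definition directions :: "nat \<Rightarrow> (nat \<Rightarrow> int) set" where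
  "directions d = (\<Pi>\<^sub>E k\<in>{..<d}. {-1, 0, 1}) - {\<lambda>k\<in>{..<d}. 0}"

definition grid_step ::
  "nat \<Rightarrow> (nat \<Rightarrow> nat) \<Rightarrow> (nat \<Rightarrow> int) \<Rightarrow> (nat \<Rightarrow> int) \<Rightarrow> nat \<Rightarrow> (nat \<Rightarrow> int)" where
  "grid_step d n p v i = (\<lambda>k\<in>{..<d}. (p k + int i * v k) mod int (n k))"

text \<open>
  A grid of shape \<open>n\<close> is a function \<open>\<Gamma>\<close> of which only the values on \<open>grid_points d n\<close> matter.
\<close>

definition appearances ::
  "nat \<Rightarrow> (nat \<Rightarrow> nat) \<Rightarrow> ((nat \<Rightarrow> int) \<Rightarrow> 'a) \<Rightarrow> 'a list \<Rightarrow> ((nat \<Rightarrow> int) \<times> (nat \<Rightarrow> int)) set" where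
  "appearances d n \<Gamma> w =
     {(p, v). p \<in> grid_points d n \<and> v \<in> directions d \<and>
              (\<forall>i<length w. \<Gamma> (grid_step d n p v i) = w ! i)}"

definition concentration ::
  "nat \<Rightarrow> (nat \<Rightarrow> nat) \<Rightarrow> ((nat \<Rightarrow> int) \<Rightarrow> 'a) \<Rightarrow> 'a list \<Rightarrow> real" where
  "concentration d n \<Gamma> w = real (card (appearances d n \<Gamma> w)) / real (card (grid_points d n))"

definition concentrations :: "nat \<Rightarrow> 'a list \<Rightarrow> real set" where
  "concentrations d w = {concentration d n \<Gamma> w | n \<Gamma>. \<forall>k<d. n k > 0}"

definition max_concentration :: "nat \<Rightarrow> 'a list \<Rightarrow> real" where
  "max_concentration d w = Sup (concentrations d w)"

definition slantable :: "nat \<Rightarrow> 'a list \<Rightarrow> bool" where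
  "slantable d w \<longleftrightarrow> max_concentration d w = (3 ^ d - 1) / 2 * max_concentration 1 w"

text \<open>The supremum is a genuine one: the set is nonempty and bounded.\<close>

lemma concentrations_nonempty: "concentrations d w \<noteq> {}"
  unfolding concentrations_def by (auto intro!: exI[of _ "\<lambda>_. 1"])

lemma bdd_above_concentrations: "bdd_above (concentrations d w)"
proof (rule bdd_aboveI)
  fix x assume "x \<in> concentrations d w"
  then obtain n \<Gamma> where x: "x = concentration d n \<Gamma> w" by (auto simp: concentrations_def)
  have fin: "finite (grid_points d n)" "finite (directions d)"
    by (auto simp: grid_points_def directions_def intro!: finite_PiE)
  have "card (appearances d n \<Gamma> w) \<le> card (grid_points d n \<times> directions d)"
    by (rule card_mono) (use fin in \<open>auto simp: appearances_def\<close>)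
  then have "real (card (appearances d n \<Gamma> w))
      \<le> real (card (directions d)) * real (card (grid_points d n))"
    by (simp add: card_cartesian_product mult.commute flip: of_nat_mult)
  then show "x \<le> real (card (directions d))"
    unfolding x concentration_def
    by (cases "card (grid_points d n) = 0") (auto simp: divide_simps)
qed

end

theory Submission
  imports Defs "HOL-Number_Theory.Cong"
begin

text \<open>
  (a) Fix a direction \<open>v\<close> and call \<open>x\<close> a mark if the line through \<open>x\<close> in direction \<open>v\<close> spells \<open>w\<close> or its
  reversal from \<open>x\<close> on. Two consecutive marks spelling \<open>u\<close> and \<open>u'\<close> are at least \<open>min_shift u u'\<close> apart,
  and the densest arrangements repeat a cycle of one or two words of \<open>{w, rev w}\<close>. A grid
  that is almost optimal in all directions therefore consists, along almost every line segment, of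
  optimal steps only. All optimal cycles contain a given letter \<open>a\<close> with the same frequency \<open>\<rho>\<close>, so
  the number of \<open>a\<close> in a segment of length \<open>N\<close> is \<open>\<rho> N\<close> up to an error of order \<open>length w\<close>, however large
  \<open>N\<close> is. On the other hand any two distinct vectors of \<open>{0,1}\<^sup>d\<close> differ by a direction, and
  positivity of \<open>\<Sum>\<^sub>x (\<Sum>\<^sub>u f (x + i u))\<^sup>2\<close>, \<open>u\<close> ranging over \<open>{0,1}\<^sup>d\<close>, shows that \<open>f\<close>, the indicator of \<open>a\<close>
  minus \<open>\<rho>\<close>, is on average almost uncorrelated or positively correlated along directions. Hence the sums
  of \<open>f\<close> over segments have second moment at least of order \<open>N / length w\<close> as long as \<open>N \<le> 2\<^sup>d / 2\<close>, which is
  a contradiction for \<open>N\<close> of order \<open>length w ^ 3\<close>.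

  (b) Two \<open>A\<close>s on a line that start appearances in the same direction are at least \<open>l\<close> apart. This
  bound is attained in all directions at once by placing \<open>A\<close> where \<open>\<Sum>k<d. 2 ^ k * x k\<close> vanishes modulo
  \<open>l\<close>, as this form takes values prime to \<open>l\<close> on directions.
\<close>

section \<open>Overlaps of a word and its reversal\<close>

text \<open>Meant for words of equal length, where \<open>g + i < length u\<close> keeps
  \<open>i\<close> inside \<open>v\<close> as well. For \<open>u = v\<close> it says that
  \<open>g\<close> is a period.\<close>

definition overlaps :: "'a list \<Rightarrow> 'a list \<Rightarrow> nat \<Rightarrow> bool" where
  "overlaps u v g \<longleftrightarrow> (\<forall>i. g + i < length u \<longrightarrow> u ! (g + i) = v ! i)"

definition min_shift :: "'a list \<Rightarrow> 'a list \<Rightarrow> nat" where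
  "min_shift u v = (LEAST g. 0 < g \<and> overlaps u v g)"

lemma overlaps_length: "overlaps u v (length u)"
  by (simp add: overlaps_def)

lemma
  assumes "u \<noteq> []"
  shows min_shift_pos: "0 < min_shift u v"
    and overlaps_min_shift: "overlaps u v (min_shift u v)"
    and min_shift_le_length: "min_shift u v \<le> length u"
proof -
  have *: "0 < length u \<and> overlaps u v (length u)"
    using assms by (simp add: overlaps_length)
  from LeastI[of "\<lambda>g. 0 < g \<and> overlaps u v g", OF *]
  show "0 < min_shift u v" "overlaps u v (min_shift u v)"
    by (simp_all add: min_shift_def)
  from * show "min_shift u v \<le> length u"
    unfolding min_shift_def by (rule Least_le)
qed

lemma min_shift_le: "0 < g \<Longrightarrow> overlaps u v g \<Longrightarrow> min_shift u v \<le> g"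
  unfolding min_shift_def by (rule Least_le) simp

lemma overlaps_rev:
  assumes "length u = length v" "overlaps u v g"
  shows "overlaps (rev v) (rev u) g"
  unfolding overlaps_def
proof (intro allI impI)
  fix i assume i: "g + i < length (rev v)"
  then have "u ! (g + (length v - Suc (g + i))) = v ! (length v - Suc (g + i))"
    using assms(2)[unfolded overlaps_def, rule_format, of "length v - Suc (g + i)"] assms(1) by simp
  moreover have "g + (length v - Suc (g + i)) = length v - Suc i"
    using i by simp
  ultimately show "rev v ! (g + i) = rev u ! i"
    using i assms(1) by (simp add: rev_nth)
qed

text \<open>Read backwards, \<open>u\<close> followed by \<open>v\<close> at distance
  \<open>g\<close> becomes \<open>rev v\<close> followed by \<open>rev u\<close> at the same
  distance.\<close>

lemma min_shift_rev:
  assumes "length u = length v"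
  shows "min_shift (rev v) (rev u) = min_shift u v"
  using overlaps_rev[of u v] overlaps_rev[of "rev v" "rev u"] assms
  unfolding min_shift_def by (metis length_rev rev_rev_ident)

section \<open>Letter counts along overlapping words\<close>

definition prefix_sum :: "('a \<Rightarrow> real) \<Rightarrow> 'a list \<Rightarrow> nat \<Rightarrow> real" where
  "prefix_sum \<chi> u n = (\<Sum>i<n. \<chi> (u ! i))"

lemma prefix_sum_add:
  "prefix_sum \<chi> u (m + n) = prefix_sum \<chi> u m + (\<Sum>i<n. \<chi> (u ! (m + i)))"
  by (induction n) (simp_all add: prefix_sum_def)

lemma prefix_sum_overlap:
  assumes "overlaps u v g" "g + n \<le> length u"
  shows "prefix_sum \<chi> u (g + n) = prefix_sum \<chi> u g + prefix_sum \<chi> v n"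
proof -
  have "(\<Sum>i<n. \<chi> (u ! (g + i))) = prefix_sum \<chi> v n"
    unfolding prefix_sum_def using assms by (intro sum.cong) (auto simp: overlaps_def)
  then show ?thesis by (simp add: prefix_sum_add)
qed

lemma prefix_sum_bounds:
  assumes "\<And>c. 0 \<le> \<chi> c" "\<And>c. \<chi> c \<le> 1"
  shows "0 \<le> prefix_sum \<chi> u n" "prefix_sum \<chi> u n \<le> real n"
  unfolding prefix_sum_def using assms
  by (auto intro: sum_nonneg order_trans[OF sum_bounded_above[of _ _ 1]])

text \<open>All blocks of \<open>p\<close> consecutive letters of a word with period
  \<open>p\<close> have the same sum, and the first block of \<open>rev w\<close> is the last block
  of \<open>w\<close> reversed.\<close>

lemma prefix_sum_rev_period:
  assumes p: "overlaps w w p" "p \<le> length w"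
  shows "prefix_sum \<chi> (rev w) p = prefix_sum \<chi> w p"
proof -
  have shift: "(\<Sum>i<p. \<chi> (w ! (m + i))) = prefix_sum \<chi> w p" if "m + p \<le> length w" for m
    using that
  proof (induction m)
    case 0
    then show ?case by (simp add: prefix_sum_def)
  next
    case (Suc m)
    have "(\<Sum>i<p. \<chi> (w ! (Suc m + i))) + \<chi> (w ! m) = (\<Sum>i<p. \<chi> (w ! (m + i))) + \<chi> (w ! (m + p))"
      using sum.lessThan_Suc_shift[of "\<lambda>i. \<chi> (w ! (m + i))" p]
      by (simp add: add.commute)
    moreover have "w ! (m + p) = w ! m"
      using p(1) Suc.prems by (simp add: overlaps_def add.commute)
    ultimately show ?case using Suc by simp
  qed
  have "prefix_sum \<chi> (rev w) p = (\<Sum>i<p. \<chi> (w ! (length w - Suc i)))"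
    unfolding prefix_sum_def using p by (intro sum.cong) (auto simp: rev_nth)
  also have "\<dots> = (\<Sum>i<p. \<chi> (w ! (length w - p + (p - Suc i))))"
    using p by (intro sum.cong) (auto intro!: arg_cong[of _ _ "\<lambda>i. \<chi> (w ! i)"])
  also have "\<dots> = (\<Sum>i<p. \<chi> (w ! (length w - p + i)))"
    by (rule sum.nat_diff_reindex)
  also have "\<dots> = prefix_sum \<chi> w p"
    using shift[of "length w - p"] p by simp
  finally show ?thesis .
qed

text \<open>Here \<open>a\<close> and \<open>b\<close> are the shifts of a 2-cycle with mean
  \<open>p\<close>. The last \<open>p - a\<close> letters of the prefix of \<open>u\<close> of
  length \<open>p\<close> are the beginning of \<open>v\<close>; by periodicity so are the last
  \<open>p - a = b - p\<close> letters of the prefix of \<open>v\<close> of length \<open>b\<close>.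
  Moving this block preserves the total.\<close>

lemma prefix_sum_exchange:
  assumes "overlaps u v a" "overlaps v v p" "a \<le> p" "a + b = 2 * p"
    and "p \<le> length u" "b \<le> length v"
  shows "prefix_sum \<chi> u a + prefix_sum \<chi> v b = prefix_sum \<chi> u p + prefix_sum \<chi> v p"
proof -
  have "prefix_sum \<chi> u p = prefix_sum \<chi> u a + prefix_sum \<chi> v (p - a)"
    using prefix_sum_overlap[of u v a "p - a" \<chi>] assms by simp
  moreover have "p + (p - a) = b" using assms by simp
  then have "prefix_sum \<chi> v b = prefix_sum \<chi> v p + prefix_sum \<chi> v (p - a)"
    using prefix_sum_overlap[of v v p "p - a" \<chi>] assms by simp
  ultimately show ?thesis by simp
qed

text \<open>
  Twice the least average distance of consecutive marks; a two-element set has no simple cycles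
  beyond loops and the 2-cycle, and the factor 2 keeps everything integral.
\<close>

definition double_gap :: "'a list \<Rightarrow> nat" where
  "double_gap w = Min ((\<lambda>(u, v). min_shift u v + min_shift v u) ` ({w, rev w} \<times> {w, rev w}))"

lemma double_gap_le:
  "u \<in> {w, rev w} \<Longrightarrow> v \<in> {w, rev w} \<Longrightarrow> double_gap w \<le> min_shift u v + min_shift v u"
  unfolding double_gap_def by (rule Min_le) auto

lemma double_gap_attained:
  obtains u v where "u \<in> {w, rev w}" "v \<in> {w, rev w}"
    "double_gap w = min_shift u v + min_shift v u"
proof -
  have "double_gap w \<in> (\<lambda>(u, v). min_shift u v + min_shift v u) ` ({w, rev w} \<times> {w, rev w})"
    unfolding double_gap_def by (rule Min_in) auto
  then show ?thesis using that by auto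
qed

lemma double_gap_pos: "w \<noteq> [] \<Longrightarrow> 0 < double_gap w"
  using double_gap_attained[of w] min_shift_pos by (metis add_pos_pos insert_iff rev_is_Nil_conv singletonD)

lemma double_gap_le_length: "w \<noteq> [] \<Longrightarrow> double_gap w \<le> 2 * length w"
  using double_gap_le[of w w w] min_shift_le_length[of w w] by simp

text \<open>If the loop at \<open>w\<close> and the 2-cycle are both optimal, they still contain each letter equally often.\<close>

lemma cycle_sum_unique:
  fixes \<chi> :: "'a \<Rightarrow> real"
  assumes w: "w \<noteq> []" and u: "u \<in> {w, rev w}" and v: "v \<in> {w, rev w}"
    and opt: "min_shift u v + min_shift v u = double_gap w"
    and u': "u' \<in> {w, rev w}" and v': "v' \<in> {w, rev w}"
    and opt': "min_shift u' v' + min_shift v' u' = double_gap w"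
  defines "cc \<equiv> \<lambda>u v. prefix_sum \<chi> u (min_shift u v) + prefix_sum \<chi> v (min_shift v u)"
  shows "cc u v = cc u' v'"
proof -
  let ?r = "rev w" and ?p = "min_shift w w"
  have r: "?r \<noteq> []" using w by simp
  have p: "min_shift ?r ?r = ?p" by (rule min_shift_rev) simp
  have le: "?p \<le> length w" using min_shift_le_length[OF w] .
  have ov: "overlaps w w ?p" "overlaps ?r ?r ?p"
    using overlaps_min_shift[OF w, of w] overlaps_min_shift[OF r, of ?r] p by simp_all
  have rr: "prefix_sum \<chi> ?r ?p = prefix_sum \<chi> w ?p"
    using prefix_sum_rev_period ov le by blast
  have cr: "cc ?r ?r = cc w w" by (simp add: cc_def p rr)
  \<comment> \<open>One of the two shifts is at most their mean \<open>?p\<close>. It takes the role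
    of \<open>a\<close> in \<open>prefix_sum_exchange\<close>, and the word it leads to that of
    \<open>v\<close>.\<close>
  have mixed: "cc w ?r = cc w w" if "min_shift w ?r + min_shift ?r w = 2 * ?p"
  proof (cases "min_shift w ?r \<le> ?p")
    case True
    from prefix_sum_exchange[OF overlaps_min_shift[OF w] ov(2) True that, of \<chi>]
    show ?thesis using le min_shift_le_length[OF r, of w] by (simp add: cc_def rr)
  next
    case False
    then have F: "min_shift ?r w \<le> ?p" using that by simp
    from prefix_sum_exchange[OF overlaps_min_shift[OF r] ov(1) F, of "min_shift w ?r" \<chi>]
    show ?thesis using that le min_shift_le_length[OF w, of ?r] by (simp add: cc_def rr add.commute)
  qed
  have sym: "cc ?r w = cc w ?r" by (simp add: cc_def)
  have ex: "cc u v = cc w w \<or> (cc u v = cc w ?r \<and> double_gap w = min_shift w ?r + min_shift ?r w)"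
    "double_gap w = 2 * ?p \<or> (cc u v = cc w ?r \<and> double_gap w = min_shift w ?r + min_shift ?r w)"
    if "u \<in> {w, ?r}" "v \<in> {w, ?r}" "min_shift u v + min_shift v u = double_gap w" for u v
    using that cr sym p by (auto simp: add.commute)
  show ?thesis
    using ex[OF u v opt] ex[OF u' v' opt'] mixed by metis
qed

text \<open>By \<open>cycle_sum_unique\<close> all optimal cycles share one letter frequency \<rho>.
  Hence the centred count of an optimal step from \<open>u\<close> to \<open>v\<close> is minus that
  of the step back, and on at most two words such an antisymmetric function is the difference of a
  potential.\<close>

lemma letter_potential:
  fixes \<chi> :: "'a \<Rightarrow> real"
  assumes w: "w \<noteq> []" and \<chi>: "\<And>c. 0 \<le> \<chi> c" "\<And>c. \<chi> c \<le> 1"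
  obtains \<rho> K where "0 \<le> \<rho>" "\<rho> \<le> 1"
    and "\<And>u. u \<in> {w, rev w} \<Longrightarrow> \<bar>K u\<bar> \<le> real (length w)"
    and "\<And>u v. u \<in> {w, rev w} \<Longrightarrow> v \<in> {w, rev w} \<Longrightarrow>
      min_shift u v + min_shift v u = double_gap w \<Longrightarrow>
      prefix_sum \<chi> u (min_shift u v) - \<rho> * real (min_shift u v) = K v - K u"
proof -
  let ?c = "\<lambda>u v. prefix_sum \<chi> u (min_shift u v)" and ?s = "\<lambda>u v. real (min_shift u v)"
  obtain u0 v0 where u0: "u0 \<in> {w, rev w}" and v0: "v0 \<in> {w, rev w}"
    and g: "double_gap w = min_shift u0 v0 + min_shift v0 u0"
    by (rule double_gap_attained)
  define \<rho> where "\<rho> = (?c u0 v0 + ?c v0 u0) / real (double_gap w)"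
  \<comment> \<open>The half difference equals the centred count of the step from \<open>w\<close>
    to \<open>u\<close> whenever that step is optimal; in particular \<open>K w = 0\<close>.\<close>
  define K where "K u = ((?c w u - ?c u w) - \<rho> * (?s w u - ?s u w)) / 2" for u
  have pos: "0 < real (double_gap w)" using double_gap_pos[OF w] by simp
  have c: "0 \<le> ?c u v" "?c u v \<le> ?s u v" for u v
    using prefix_sum_bounds[of \<chi> u "min_shift u v"] \<chi> by auto
  have s: "?s u v \<le> real (length w)" if "u \<in> {w, rev w}" for u v
  proof -
    have "u \<noteq> []" "length u = length w" using that w by auto
    then show ?thesis using min_shift_le_length[of u v] by simp
  qed
  have \<rho>: "0 \<le> \<rho>" "\<rho> \<le> 1"
    unfolding \<rho>_def using pos c[of u0 v0] c[of v0 u0] g by (auto simp: field_simps)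
  have bound: "\<bar>K u\<bar> \<le> real (length w)" if u: "u \<in> {w, rev w}" for u
  proof -
    have "\<bar>?c w u - ?c u w\<bar> \<le> real (length w)"
      using c[of w u] c[of u w] s[of w u] s[of u w] u by auto
    moreover have "\<bar>?s w u - ?s u w\<bar> \<le> real (length w)"
      using s[of w u] s[of u w] u by auto
    then have "\<bar>\<rho> * (?s w u - ?s u w)\<bar> \<le> 1 * real (length w)"
      unfolding abs_mult using \<rho> by (intro mult_mono) auto
    ultimately show ?thesis
      unfolding K_def using abs_triangle_ineq4[of "?c w u - ?c u w" "\<rho> * (?s w u - ?s u w)"] by simp
  qed
  have edge: "?c u v - \<rho> * ?s u v = K v - K u"
    if u: "u \<in> {w, rev w}" and v: "v \<in> {w, rev w}"
      and opt: "min_shift u v + min_shift v u = double_gap w" for u v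
  proof -
    have "?c u v + ?c v u = ?c u0 v0 + ?c v0 u0"
      by (rule cycle_sum_unique[OF w u v opt u0 v0]) (use g in simp)
    then have "?c u v + ?c v u = \<rho> * real (double_gap w)"
      unfolding \<rho>_def using pos by simp
    then have eq: "?c u v + ?c v u = \<rho> * ?s u v + \<rho> * ?s v u"
      by (simp add: opt[symmetric] algebra_simps)
    show ?thesis using u v eq by (auto simp: K_def field_simps)
  qed
  from that[OF \<rho> bound edge] show ?thesis by blast
qed

text \<open>The first \<open>p\<close> letters of \<open>u\<close> and the first \<open>q\<close>
  letters of \<open>v\<close>, repeated, realise the cycle of the two words.\<close>

lemma periodic_realization:
  assumes "u \<noteq> []" "v \<noteq> []" "length u = length v"
  defines "p \<equiv> min_shift u v" and "q \<equiv> min_shift v u"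
  obtains s where "\<And>i. i < length u \<Longrightarrow> s (i mod (p + q)) = u ! i"
    "\<And>i. i < length u \<Longrightarrow> s ((p + i) mod (p + q)) = v ! i"
proof -
  define s where "s i = (if i < p then u ! i else v ! (i - p))" for i
  have p: "0 < p" "overlaps u v p" and q: "0 < q" "overlaps v u q"
    using assms min_shift_pos overlaps_min_shift by blast+
  \<comment> \<open>Both claims go together: letter \<open>i \<ge> p\<close> of \<open>u\<close> is
    letter \<open>i - p\<close> of the copy of \<open>v\<close>, and letter \<open>i \<ge> q\<close>
    of \<open>v\<close> is letter \<open>i - q\<close> of the next copy of \<open>u\<close>.\<close>
  have "i < length u \<longrightarrow> s (i mod (p + q)) = u ! i \<and> s ((p + i) mod (p + q)) = v ! i" for i
  proof (induction i rule: less_induct)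
    case (less i)
    show ?case
    proof (intro impI conjI)
      assume i: "i < length u"
      show "s (i mod (p + q)) = u ! i"
      proof (cases "i < p")
        case True
        then show ?thesis by (simp add: s_def)
      next
        case False
        then have "s (i mod (p + q)) = v ! (i - p)"
          using less.IH[of "i - p"] p i by simp
        also have "\<dots> = u ! i"
          using p(2) False i by (simp add: overlaps_def) (metis le_add_diff_inverse not_less)
        finally show ?thesis .
      qed
      show "s ((p + i) mod (p + q)) = v ! i"
      proof (cases "i < q")
        case True
        then show ?thesis by (simp add: s_def)
      next
        case False
        have "(p + i) mod (p + q) = (i - q) mod (p + q)"
        proof -
          have "p + i = (i - q) + (p + q)" using False by simp
          then show ?thesis by (metis mod_add_self2)
        qed
        then have "s ((p + i) mod (p + q)) = u ! (i - q)"
          using less.IH[of "i - q"] q i False by simp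
        also have "\<dots> = v ! i"
          using q(2) False i assms(3) by (simp add: overlaps_def) (metis le_add_diff_inverse not_less)
        finally show ?thesis .
      qed
    qed
  qed
  then show ?thesis using that by blast
qed

section \<open>Marks along a permutation\<close>

text \<open>In the application \<open>X\<close> is the set of grid points and \<sigma> the
  translation by a direction. The common period \<open>P\<close> guarantees that every mark is
  followed by a mark on its orbit, possibly by itself.\<close>

locale word_system =
  fixes X :: "'x set" and \<sigma> :: "'x \<Rightarrow> 'x" and \<Gamma> :: "'x \<Rightarrow> 'a" and w :: "'a list" and P :: nat
  assumes finite_X: "finite X"
    and bij_\<sigma>: "bij_betw \<sigma> X X"
    and P_pos: "0 < P"
    and period: "\<And>x. x \<in> X \<Longrightarrow> (\<sigma> ^^ P) x = x"
    and w_ne: "w \<noteq> []"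
begin

definition word :: "'x \<Rightarrow> 'a list" where
  "word x = map (\<lambda>i. \<Gamma> ((\<sigma> ^^ i) x)) [0..<length w]"

definition marks :: "'x set" where
  "marks = {x \<in> X. word x \<in> {w, rev w}}"

definition gap :: "'x \<Rightarrow> nat" where
  "gap x = (LEAST g. 0 < g \<and> (\<sigma> ^^ g) x \<in> marks)"

definition succ_mark :: "'x \<Rightarrow> 'x" where
  "succ_mark x = (\<sigma> ^^ gap x) x"

text \<open>
  Twice the amount by which the gap after a mark exceeds the optimal average, corrected by a
  coboundary that makes it nonnegative.
\<close>

definition excess :: "'x \<Rightarrow> int" where
  "excess x = 2 * int (gap x) - int (double_gap w)
     + (int (min_shift (word (succ_mark x)) w) - int (min_shift w (word (succ_mark x))))
     - (int (min_shift (word x) w) - int (min_shift w (word x)))"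

text \<open>Excess 0 makes the step after a mark optimal, so these are the positions where
  \<open>letter_potential\<close> controls the letter counts.\<close>

definition good :: "'x set" where
  "good = {(\<sigma> ^^ j) y | y j. y \<in> marks \<and> excess y = 0 \<and> j < gap y}"

lemma bij_pow: "bij_betw (\<sigma> ^^ i) X X"
proof (induction i)
  case 0
  show ?case by (simp add: bij_betw_def)
next
  case (Suc i)
  then show ?case using bij_betw_trans[OF Suc bij_\<sigma>] by (simp add: comp_def)
qed

lemma pow_in: "x \<in> X \<Longrightarrow> (\<sigma> ^^ i) x \<in> X"
  using bij_pow bij_betwE by blast

lemma pow_inj: "x \<in> X \<Longrightarrow> y \<in> X \<Longrightarrow> (\<sigma> ^^ i) x = (\<sigma> ^^ i) y \<Longrightarrow> x = y"
  using bij_pow[of i] by (auto simp: bij_betw_def inj_on_def)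

lemma pow_cancel:
  assumes "x \<in> X" "y \<in> X" "(\<sigma> ^^ i) x = (\<sigma> ^^ j) y" "i \<le> j"
  shows "x = (\<sigma> ^^ (j - i)) y"
proof -
  have "(\<sigma> ^^ i) x = (\<sigma> ^^ i) ((\<sigma> ^^ (j - i)) y)"
    using assms(3,4) by (metis comp_apply funpow_add le_add_diff_inverse)
  then show ?thesis using assms pow_in pow_inj by blast
qed

lemma sum_pow: "(\<Sum>x\<in>X. f ((\<sigma> ^^ i) x)) = (\<Sum>x\<in>X. f x)"
  using sum.reindex_bij_betw[OF bij_pow] .

lemma marksD: "x \<in> marks \<Longrightarrow> x \<in> X" "x \<in> marks \<Longrightarrow> word x \<in> {w, rev w}"
  by (auto simp: marks_def)

lemma finite_marks: "finite marks"
  using finite_X by (simp add: marks_def)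

lemma length_word [simp]: "length (word x) = length w"
  by (simp add: word_def)

lemma word_ne [simp]: "word x \<noteq> []"
  using w_ne by (metis length_word length_0_conv)

lemma word_nth: "i < length w \<Longrightarrow> word x ! i = \<Gamma> ((\<sigma> ^^ i) x)"
  by (simp add: word_def)

lemma overlaps_word: "overlaps (word x) (word ((\<sigma> ^^ g) x)) g"
  unfolding overlaps_def by (auto simp: word_nth funpow_add add.commute[of g])

lemma
  assumes "x \<in> marks"
  shows gap_pos: "0 < gap x" and succ_mark_in: "succ_mark x \<in> marks"
proof -
  have "0 < P \<and> (\<sigma> ^^ P) x \<in> marks"
    using P_pos period assms marksD by simp
  from LeastI[of "\<lambda>g. 0 < g \<and> (\<sigma> ^^ g) x \<in> marks", OF this]
  show "0 < gap x" "succ_mark x \<in> marks" by (simp_all add: gap_def succ_mark_def)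
qed

lemma before_gap: "j < gap x \<Longrightarrow> (\<sigma> ^^ j) x \<in> marks \<Longrightarrow> j = 0"
  using not_less_Least[of j "\<lambda>g. 0 < g \<and> (\<sigma> ^^ g) x \<in> marks"] by (auto simp: gap_def)

text \<open>Stretches following distinct marks are disjoint: at a common point, cancelling the
  smaller exponent puts one mark inside the stretch of the other, where only offset 0 is a
  mark.\<close>

lemma inj_cells: "inj_on (\<lambda>(x, j). (\<sigma> ^^ j) x) (SIGMA x:marks. {..<gap x})"
proof -
  have *: "x = y \<and> i = j"
    if "x \<in> marks" "y \<in> marks" "j < gap y" "(\<sigma> ^^ i) x = (\<sigma> ^^ j) y" "i \<le> j" for x y i j
  proof -
    have x: "x = (\<sigma> ^^ (j - i)) y"
      using pow_cancel that marksD by blast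
    then have "(\<sigma> ^^ (j - i)) y \<in> marks" using that(1) by metis
    then have "j - i = 0"
      by (rule before_gap[rotated]) (use that(3) in linarith)
    then show ?thesis using x that(5) by force
  qed
  show ?thesis
  proof (rule inj_onI, clarsimp)
    fix x i y j
    assume a: "x \<in> marks" "y \<in> marks" "i < gap x" "j < gap y" "(\<sigma> ^^ i) x = (\<sigma> ^^ j) y"
    consider "i \<le> j" | "j \<le> i" by linarith
    then show "x = y \<and> i = j"
    proof cases
      case 1
      then show ?thesis by (rule *[OF a(1,2,4,5)])
    next
      case 2
      then show ?thesis using *[OF a(2,1,3) a(5)[symmetric]] by blast
    qed
  qed
qed

lemma card_cells:
  assumes "M \<subseteq> marks"
  shows "card ((\<lambda>(x, j). (\<sigma> ^^ j) x) ` (SIGMA x:M. {..<gap x})) = (\<Sum>x\<in>M. gap x)"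
proof -
  have "inj_on (\<lambda>(x, j). (\<sigma> ^^ j) x) (SIGMA x:M. {..<gap x})"
    by (rule inj_on_subset[OF inj_cells]) (use assms in auto)
  then have "card ((\<lambda>(x, j). (\<sigma> ^^ j) x) ` (SIGMA x:M. {..<gap x})) = card (SIGMA x:M. {..<gap x})"
    by (rule card_image)
  also have "\<dots> = (\<Sum>x\<in>M. gap x)"
    using finite_subset[OF assms finite_marks] by simp
  finally show ?thesis .
qed

text \<open>Only an inequality, since orbits without marks are not covered by stretches.\<close>

lemma sum_gap_le: "(\<Sum>x\<in>marks. gap x) \<le> card X"
  unfolding card_cells[OF subset_refl, symmetric]
  by (rule card_mono[OF finite_X]) (auto simp: marksD pow_in)

text \<open>Of two different marks with the same successor, the one with the smaller gap would lie
  strictly between the other one and that successor.\<close>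

lemma bij_succ_mark: "bij_betw succ_mark marks marks"
proof -
  have *: "x = y"
    if "x \<in> marks" "y \<in> marks" "succ_mark x = succ_mark y" "gap x \<le> gap y" for x y
  proof -
    have x: "x = (\<sigma> ^^ (gap y - gap x)) y"
      using pow_cancel that marksD unfolding succ_mark_def by blast
    moreover have "gap y - gap x < gap y" using that gap_pos by simp
    ultimately have "gap y - gap x = 0" using before_gap that by metis
    then show ?thesis using x by simp
  qed
  then have "inj_on succ_mark marks"
    by (intro inj_onI) (metis nat_le_linear)
  moreover have "succ_mark ` marks \<subseteq> marks" using succ_mark_in by auto
  ultimately show ?thesis
    by (simp add: bij_betw_def endo_inj_surj finite_marks)
qed

section \<open>Excess and density of marks\<close>

lemma sum_excess:
  "(\<Sum>x\<in>marks. excess x) = 2 * int (\<Sum>x\<in>marks. gap x) - int (double_gap w) * int (card marks)"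
proof -
  let ?H = "\<lambda>x. int (min_shift (word x) w) - int (min_shift w (word x))"
  have "(\<Sum>x\<in>marks. ?H (succ_mark x)) = (\<Sum>x\<in>marks. ?H x)"
    using sum.reindex_bij_betw[OF bij_succ_mark, of ?H] .
  then show ?thesis
    by (simp add: excess_def sum.distrib sum_subtractf sum_distrib_left)
qed

text \<open>The correction in \<open>excess\<close> equals
  \<open>min_shift v u - min_shift u v\<close> for each of the four pairs of readings. This splits
  the excess into two nonnegative parts: twice the slack of the gap over the least shift, and the
  slack of the 2-cycle over the optimum.\<close>

lemma excess_eq:
  assumes "x \<in> marks"
  defines "u \<equiv> word x" and "v \<equiv> word (succ_mark x)"
  shows "excess x = 2 * (int (gap x) - int (min_shift u v))
    + (int (min_shift u v) + int (min_shift v u) - int (double_gap w))"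
  using marksD(2)[OF assms(1)] marksD(2)[OF succ_mark_in[OF assms(1)]]
    min_shift_rev[of w w]
  by (auto simp: excess_def u_def v_def)

lemma min_shift_le_gap: "x \<in> marks \<Longrightarrow> min_shift (word x) (word (succ_mark x)) \<le> gap x"
  unfolding succ_mark_def by (intro min_shift_le gap_pos overlaps_word)

lemma double_gap_le_marks:
  assumes "x \<in> marks"
  shows "double_gap w \<le> min_shift (word x) (word (succ_mark x)) + min_shift (word (succ_mark x)) (word x)"
  using assms by (intro double_gap_le marksD succ_mark_in)

lemma excess_nonneg: "x \<in> marks \<Longrightarrow> 0 \<le> excess x"
  using excess_eq min_shift_le_gap double_gap_le_marks by fastforce

lemma excess_zero:
  assumes "x \<in> marks" "excess x = 0"
  defines "u \<equiv> word x" and "v \<equiv> word (succ_mark x)"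
  shows "gap x = min_shift u v" "min_shift u v + min_shift v u = double_gap w"
  using assms(2) excess_eq[OF assms(1)] min_shift_le_gap[OF assms(1)] double_gap_le_marks[OF assms(1)]
  by (simp_all add: u_def v_def)

lemma double_gap_marks_le: "double_gap w * card marks \<le> 2 * card X"
proof -
  have "0 \<le> (\<Sum>x\<in>marks. excess x)" by (intro sum_nonneg excess_nonneg)
  then have "int (double_gap w * card marks) \<le> int (2 * (\<Sum>x\<in>marks. gap x))"
    unfolding sum_excess by simp
  then show ?thesis using sum_gap_le by linarith
qed

text \<open>A gap is at most the excess plus one word length, and by integrality a nonzero excess is
  at least 1, so it pays for the word length as well.\<close>

lemma gap_le_excess:
  assumes "x \<in> marks" "excess x \<noteq> 0"
  shows "int (gap x) \<le> (int (length w) + 1) * excess x"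
proof -
  have e: "1 \<le> excess x" using excess_nonneg[OF assms(1)] assms(2) by simp
  have "int (gap x) \<le> excess x + int (length w)"
    using excess_eq[OF assms(1)] min_shift_le_gap[OF assms(1)] double_gap_le_marks[OF assms(1)]
      min_shift_le_length[of "word x" "word (succ_mark x)"] by simp
  also have "\<dots> \<le> excess x + int (length w) * excess x"
    using e by (simp add: mult_le_cancel_left1)
  finally show ?thesis by (simp add: algebra_simps)
qed

text \<open>The last factor is the deficiency from the optimal density. It equals the total excess
  plus twice the number of points on orbits without marks, and each bad point either lies on such an
  orbit or follows a mark of positive excess.\<close>

lemma card_not_good:
  "real (card (X - good)) \<le> (real (length w) + 1) * (2 * real (card X) - real (double_gap w) * real (card marks))"
proof -
  let ?A = "{x \<in> marks. excess x = 0}" and ?S = "int (\<Sum>x\<in>marks. gap x)" and ?L = "int (length w) + 1"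
  have good: "good = (\<lambda>(x, j). (\<sigma> ^^ j) x) ` (SIGMA x:?A. {..<gap x})"
    unfolding good_def by force
  have "good \<subseteq> X" unfolding good_def using marksD pow_in by auto
  then have "int (card (X - good)) = int (card X) - int (card good)"
    using finite_X by (simp add: card_Diff_subset finite_subset card_mono of_nat_diff)
  moreover have "int (card good) = (\<Sum>x\<in>?A. int (gap x))"
    unfolding good using card_cells[of ?A] by simp
  moreover have "?S = (\<Sum>x\<in>marks - ?A. int (gap x)) + (\<Sum>x\<in>?A. int (gap x))"
    using sum.subset_diff[of ?A marks "\<lambda>x. int (gap x)"] finite_marks by simp
  moreover have "(\<Sum>x\<in>marks - ?A. int (gap x)) \<le> (\<Sum>x\<in>marks - ?A. ?L * excess x)"
    using gap_le_excess by (intro sum_mono) auto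
  moreover have "(\<Sum>x\<in>marks - ?A. ?L * excess x) \<le> (\<Sum>x\<in>marks. ?L * excess x)"
    using excess_nonneg finite_marks by (intro sum_mono2) auto
  moreover have "(\<Sum>x\<in>marks. ?L * excess x) = ?L * (2 * ?S - int (double_gap w) * int (card marks))"
    by (simp only: sum_distrib_left[symmetric] sum_excess)
  ultimately have *: "int (card (X - good)) \<le>
      (int (card X) - ?S) + ?L * (2 * ?S - int (double_gap w) * int (card marks))"
    by linarith
  have "int (card X) - ?S \<le> ?L * (2 * (int (card X) - ?S))"
  proof -
    have "0 \<le> int (card X) - ?S" using sum_gap_le by linarith
    then have "1 * (int (card X) - ?S) \<le> (2 * ?L) * (int (card X) - ?S)"
      by (intro mult_right_mono) auto
    then show ?thesis by (simp only: mult_1 mult.assoc mult.left_commute)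
  qed
  with * have "int (card (X - good)) \<le> ?L * (2 * int (card X) - int (double_gap w) * int (card marks))"
    by (simp add: algebra_simps)
  then have "real_of_int (int (card (X - good))) \<le>
      real_of_int (?L * (2 * int (card X) - int (double_gap w) * int (card marks)))"
    by (simp only: of_int_le_iff)
  then show ?thesis by simp
qed

section \<open>Letter sums over windows\<close>

text \<open>Along good positions the centred letter values telescope, so the bound does not depend
  on \<open>N\<close>: each end contributes one word length from \<open>K\<close> and one from a
  partial step. Position \<open>N\<close>, just after the last summand, must be good too in order to
  have such a representation.\<close>

lemma good_window:
  fixes \<chi> :: "'a \<Rightarrow> real"
  assumes \<chi>: "\<And>c. 0 \<le> \<chi> c" "\<And>c. \<chi> c \<le> 1"
    and \<rho>: "0 \<le> \<rho>" "\<rho> \<le> 1"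
    and K: "\<And>u. u \<in> {w, rev w} \<Longrightarrow> \<bar>K u\<bar> \<le> real (length w)"
    and edge: "\<And>u v. u \<in> {w, rev w} \<Longrightarrow> v \<in> {w, rev w} \<Longrightarrow>
      min_shift u v + min_shift v u = double_gap w \<Longrightarrow>
      prefix_sum \<chi> u (min_shift u v) - \<rho> * real (min_shift u v) = K v - K u"
    and x: "\<And>i. i \<le> N \<Longrightarrow> (\<sigma> ^^ i) x \<in> good"
  shows "\<bar>\<Sum>i<N. \<chi> (\<Gamma> ((\<sigma> ^^ i) x)) - \<rho>\<bar> \<le> 4 * real (length w)"
proof -
  define rep where "rep y j z \<longleftrightarrow> y \<in> marks \<and> excess y = 0 \<and> j < gap y \<and> z = (\<sigma> ^^ j) y" for y j z
  \<comment> \<open>on good cells \<open>\<chi> \<circ> \<Gamma> - \<rho>\<close> is the coboundary of the bounded function \<open>\<Psi>\<close>\<close>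
  define \<Psi> where "\<Psi> y j = K (word y) + (prefix_sum \<chi> (word y) j - \<rho> * real j)" for y j
  have gap_le: "gap y \<le> length w" if "y \<in> marks" "excess y = 0" for y
    using excess_zero[OF that] min_shift_le_length[of "word y" "word (succ_mark y)"] by simp
  have bound: "\<bar>\<Psi> y j\<bar> \<le> 2 * real (length w)" if "rep y j z" for y j z
  proof -
    have y: "y \<in> marks" "j \<le> length w"
      using that gap_le unfolding rep_def by force+
    have "0 \<le> \<rho> * real j" "\<rho> * real j \<le> real j"
      using \<rho> by (auto intro: mult_left_le_one_le)
    then have "\<bar>prefix_sum \<chi> (word y) j - \<rho> * real j\<bar> \<le> real j"
      using prefix_sum_bounds[of \<chi> "word y" j] \<chi> by auto
    then show ?thesis
      unfolding \<Psi>_def using K[OF marksD(2)[OF y(1)]] y(2) by linarith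
  qed
  have step: "\<exists>y' j'. rep y' j' (\<sigma> z) \<and> \<Psi> y' j' = \<Psi> y j + (\<chi> (\<Gamma> z) - \<rho>)"
    if r: "rep y j z" and g: "\<sigma> z \<in> good" for y j z
  proof -
    have y: "y \<in> marks" "excess y = 0" "j < gap y" "z = (\<sigma> ^^ j) y"
      using r by (auto simp: rep_def)
    have "j < length w" using gap_le y by fastforce
    then have \<Psi>: "\<Psi> y (Suc j) = \<Psi> y j + (\<chi> (\<Gamma> z) - \<rho>)"
      by (simp add: \<Psi>_def prefix_sum_def word_nth y(4) algebra_simps)
    show ?thesis
    proof (cases "Suc j < gap y")
      case True
      then have "rep y (Suc j) (\<sigma> z)" using y by (simp add: rep_def)
      then show ?thesis using \<Psi> by blast
    next
      case False
      \<comment> \<open>At the end of a stretch the representation passes to the next mark with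
        offset 0, and the potential difference given by \<open>edge\<close> keeps the value of
        \<Psi>.\<close>
      then have j: "Suc j = gap y" using y(3) by simp
      then have s: "\<sigma> z = succ_mark y"
        by (simp add: succ_mark_def y(4) flip: j)
      from g obtain y' j' where y': "y' \<in> marks" "excess y' = 0" "j' < gap y'" "\<sigma> z = (\<sigma> ^^ j') y'"
        by (auto simp: good_def)
      \<comment> \<open>A good position that is itself a mark can only be represented with offset 0,
        so its own excess vanishes.\<close>
      then have "j' = 0"
        using before_gap[of j' y'] succ_mark_in[OF y(1)] s by simp
      then have r': "rep (\<sigma> z) 0 (\<sigma> z)" using y' by (simp add: rep_def)
      have "K (word (succ_mark y)) - K (word y) =
          prefix_sum \<chi> (word y) (gap y) - \<rho> * real (gap y)"
        using edge[OF marksD(2)[OF y(1)] marksD(2)[OF succ_mark_in[OF y(1)]]]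
          excess_zero[OF y(1,2)] by simp
      then have "\<Psi> (\<sigma> z) 0 = \<Psi> y (Suc j)"
        by (simp add: \<Psi>_def prefix_sum_def s j)
      with r' \<Psi> show ?thesis by auto
    qed
  qed
  obtain y j where r: "rep y j x"
    using x[of 0] by (auto simp: good_def rep_def)
  have "\<exists>y' j'. rep y' j' ((\<sigma> ^^ n) x) \<and>
      \<Psi> y' j' = \<Psi> y j + (\<Sum>i<n. \<chi> (\<Gamma> ((\<sigma> ^^ i) x)) - \<rho>)" if "n \<le> N" for n
    using that
  proof (induction n)
    case 0
    then show ?case using r by auto
  next
    case (Suc n)
    then obtain y' j' where y': "rep y' j' ((\<sigma> ^^ n) x)"
      "\<Psi> y' j' = \<Psi> y j + (\<Sum>i<n. \<chi> (\<Gamma> ((\<sigma> ^^ i) x)) - \<rho>)" by auto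
    show ?case using step[OF y'(1)] x[OF Suc.prems] y'(2) by force
  qed
  from this[OF order_refl] obtain y' j' where "rep y' j' ((\<sigma> ^^ N) x)"
    "\<Psi> y' j' = \<Psi> y j + (\<Sum>i<N. \<chi> (\<Gamma> ((\<sigma> ^^ i) x)) - \<rho>)" by blast
  then show ?thesis using bound[OF r] bound[of y' j'] by fastforce
qed

text \<open>A window of good positions has a sum of at most \<open>4 * length w\<close> in absolute
  value. Any other window gets the trivial bound \<open>N\<close>, charged to a bad one among its
  \<open>N + 1\<close> positions; summed over \<open>X\<close>, each bad point is counted once per
  offset.\<close>

lemma window_second_moment:
  fixes \<chi> :: "'a \<Rightarrow> real"
  assumes \<chi>: "\<And>c. 0 \<le> \<chi> c" "\<And>c. \<chi> c \<le> 1"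
    and \<rho>: "0 \<le> \<rho>" "\<rho> \<le> 1"
    and K: "\<And>u. u \<in> {w, rev w} \<Longrightarrow> \<bar>K u\<bar> \<le> real (length w)"
    and edge: "\<And>u v. u \<in> {w, rev w} \<Longrightarrow> v \<in> {w, rev w} \<Longrightarrow>
      min_shift u v + min_shift v u = double_gap w \<Longrightarrow>
      prefix_sum \<chi> u (min_shift u v) - \<rho> * real (min_shift u v) = K v - K u"
  shows "(\<Sum>x\<in>X. (\<Sum>i<N. \<chi> (\<Gamma> ((\<sigma> ^^ i) x)) - \<rho>)\<^sup>2) \<le>
    16 * (real (length w))\<^sup>2 * real (card X) + (real N)\<^sup>2 * (real N + 1) * (real (length w) + 1)
      * (2 * real (card X) - real (double_gap w) * real (card marks))"
proof -
  let ?S = "\<lambda>x. \<Sum>i<N. \<chi> (\<Gamma> ((\<sigma> ^^ i) x)) - \<rho>" and ?l = "real (length w)"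
  let ?bad = "\<lambda>x. if x \<in> good then 0 else 1 :: real"
  have pt: "(?S x)\<^sup>2 \<le> 16 * ?l\<^sup>2 + (real N)\<^sup>2 * (\<Sum>i\<le>N. ?bad ((\<sigma> ^^ i) x))" for x
  proof (cases "\<forall>i\<le>N. (\<sigma> ^^ i) x \<in> good")
    case True
    then have "\<bar>?S x\<bar> \<le> 4 * ?l"
      using good_window[OF \<chi> \<rho> K edge] by blast
    then have "(?S x)\<^sup>2 \<le> (4 * ?l)\<^sup>2" by (rule power2_le_iff_abs_le[THEN iffD2, rotated]) simp
    moreover have "0 \<le> (real N)\<^sup>2 * (\<Sum>i\<le>N. ?bad ((\<sigma> ^^ i) x))"
      by (intro mult_nonneg_nonneg sum_nonneg) auto
    ultimately show ?thesis by (simp add: power_mult_distrib)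
  next
    case False
    then obtain i where i: "i \<le> N" "(\<sigma> ^^ i) x \<notin> good" by blast
    have "\<bar>?S x\<bar> \<le> (\<Sum>i<N. \<bar>\<chi> (\<Gamma> ((\<sigma> ^^ i) x)) - \<rho>\<bar>)" by (rule sum_abs)
    also have "\<dots> \<le> (\<Sum>i<N. 1)"
    proof (rule sum_mono)
      fix i show "\<bar>\<chi> (\<Gamma> ((\<sigma> ^^ i) x)) - \<rho>\<bar> \<le> 1"
        using \<chi>(1)[of "\<Gamma> ((\<sigma> ^^ i) x)"] \<chi>(2)[of "\<Gamma> ((\<sigma> ^^ i) x)"] \<rho> by linarith
    qed
    finally have "(?S x)\<^sup>2 \<le> (real N)\<^sup>2"
      by (intro power2_le_iff_abs_le[THEN iffD2]) auto
    moreover have "1 \<le> (\<Sum>i\<le>N. ?bad ((\<sigma> ^^ i) x))"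
      using member_le_sum[of i "{..N}" "\<lambda>i. ?bad ((\<sigma> ^^ i) x)"] i by auto
    then have "(real N)\<^sup>2 * 1 \<le> (real N)\<^sup>2 * (\<Sum>i\<le>N. ?bad ((\<sigma> ^^ i) x))"
      by (intro mult_left_mono) auto
    moreover have "0 \<le> 16 * ?l\<^sup>2" by simp
    ultimately show ?thesis by linarith
  qed
  have bad: "(\<Sum>x\<in>X. ?bad x) = real (card (X - good))"
  proof -
    have "(\<Sum>x\<in>X. ?bad x) = (\<Sum>x\<in>X - good. ?bad x)"
      using finite_X by (intro sum.mono_neutral_right) auto
    then show ?thesis by simp
  qed
  have "(\<Sum>x\<in>X. (?S x)\<^sup>2) \<le> (\<Sum>x\<in>X. 16 * ?l\<^sup>2 + (real N)\<^sup>2 * (\<Sum>i\<le>N. ?bad ((\<sigma> ^^ i) x)))"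
    by (intro sum_mono pt)
  also have "\<dots> = 16 * ?l\<^sup>2 * real (card X) + (real N)\<^sup>2 * (\<Sum>i\<le>N. \<Sum>x\<in>X. ?bad ((\<sigma> ^^ i) x))"
    by (simp add: sum.distrib sum_distrib_left[symmetric] sum.swap[of _ X])
  also have "(\<Sum>i\<le>N. \<Sum>x\<in>X. ?bad ((\<sigma> ^^ i) x)) = (real N + 1) * real (card (X - good))"
    using sum_pow[of ?bad] bad by simp
  also have "\<dots> \<le> (real N + 1) * ((?l + 1) * (2 * real (card X) - real (double_gap w) * real (card marks)))"
    by (intro mult_left_mono card_not_good) simp
  finally show ?thesis by (simp add: mult.assoc mult_left_mono)
qed

text \<open>Each of the two readings contains the letter at a fixed offset, and moving by that
  offset is injective.\<close>

lemma card_marks_le_letter: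
  assumes "c \<in> set w"
  shows "card marks \<le> 2 * card {x \<in> X. \<Gamma> x = c}"
proof -
  have *: "card {x \<in> X. word x = u} \<le> card {x \<in> X. \<Gamma> x = c}" if u: "u \<in> {w, rev w}" for u
  proof -
    have "c \<in> set u" "length u = length w" using u assms by auto
    then obtain j where j: "j < length w" "u ! j = c" by (metis in_set_conv_nth)
    show ?thesis
    proof (rule card_inj_on_le[of "\<sigma> ^^ j"])
      show "inj_on (\<sigma> ^^ j) {x \<in> X. word x = u}"
        by (rule inj_on_subset[OF bij_betw_imp_inj_on[OF bij_pow]]) auto
      show "(\<sigma> ^^ j) ` {x \<in> X. word x = u} \<subseteq> {x \<in> X. \<Gamma> x = c}"
        using j pow_in word_nth[of j] by auto
    qed (use finite_X in auto)
  qed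
  have "marks = {x \<in> X. word x = w} \<union> {x \<in> X. word x = rev w}" by (auto simp: marks_def)
  then have "card marks \<le> card {x \<in> X. word x = w} + card {x \<in> X. word x = rev w}"
    by (simp add: card_Un_le)
  then show ?thesis using *[of w] *[of "rev w"] by simp
qed

end

section \<open>Lines and correlations in a grid\<close>

definition shift :: "nat \<Rightarrow> (nat \<Rightarrow> nat) \<Rightarrow> (nat \<Rightarrow> int) \<Rightarrow> (nat \<Rightarrow> int) \<Rightarrow> nat \<Rightarrow> int" where
  "shift d n p z = (\<lambda>k\<in>{..<d}. (p k + z k) mod int (n k))"

lemma grid_step_eq_shift: "grid_step d n p v i = shift d n p (\<lambda>k. int i * v k)"
  by (simp add: grid_step_def shift_def)

lemma shift_cong: "(\<And>k. k < d \<Longrightarrow> z k = z' k) \<Longrightarrow> shift d n p z = shift d n p z'"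
  unfolding shift_def by (intro restrict_ext) auto

lemma shift_shift: "shift d n (shift d n p z) z' = shift d n p (\<lambda>k. z k + z' k)"
  unfolding shift_def by (intro restrict_ext) (auto simp: mod_simps add.assoc)

lemma finite_grid_points: "finite (grid_points d n)"
  by (auto simp: grid_points_def intro!: finite_PiE)

lemma finite_directions: "finite (directions d)"
  by (auto simp: directions_def intro!: finite_PiE)

lemma card_directions: "card (directions d) = 3 ^ d - 1"
proof -
  have "card (\<Pi>\<^sub>E k\<in>{..<d}. {-1, 0, 1 :: int}) = 3 ^ d"
    by (subst card_PiE) (auto simp: numeral_3_eq_3)
  then show ?thesis
    unfolding directions_def by (subst card_Diff_singleton) auto
qed

definition neg_dir :: "nat \<Rightarrow> (nat \<Rightarrow> int) \<Rightarrow> nat \<Rightarrow> int" where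
  "neg_dir d v = (\<lambda>k\<in>{..<d}. - v k)"

lemma neg_dir_neg_dir: "v \<in> directions d \<Longrightarrow> neg_dir d (neg_dir d v) = v"
  by (auto simp: neg_dir_def directions_def PiE_def extensional_def fun_eq_iff)

lemma neg_dir_in: "v \<in> directions d \<Longrightarrow> neg_dir d v \<in> directions d"
  by (auto simp: neg_dir_def directions_def PiE_def extensional_def fun_eq_iff Pi_def
      split: if_splits)

lemma bij_neg_dir: "bij_betw (neg_dir d) (directions d) (directions d)"
  by (rule bij_betw_byWitness[of _ "neg_dir d"]) (auto simp: neg_dir_neg_dir neg_dir_in)

text \<open>Number of appearances of \<open>w\<close>, in the two opposite directions together, belonging to one mark.\<close>

definition reading_count :: "'a list \<Rightarrow> nat" where
  "reading_count w = (if w = rev w then 2 else 1)"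

locale grid =
  fixes d :: nat and n :: "nat \<Rightarrow> nat"
  assumes n_pos: "\<And>k. k < d \<Longrightarrow> 0 < n k"
begin

abbreviation G where "G \<equiv> grid_points d n"
abbreviation sh where "sh \<equiv> shift d n"

lemma shift_in: "sh p z \<in> G"
  using n_pos by (auto simp: shift_def grid_points_def)

lemma shift_zero:
  assumes "p \<in> G" "\<And>k. k < d \<Longrightarrow> int (n k) dvd z k"
  shows "sh p z = p"
proof
  fix k
  show "sh p z k = p k"
  proof (cases "k < d")
    case True
    then obtain c where "z k = int (n k) * c" using assms(2) by (auto simp: dvd_def)
    then show ?thesis using assms(1) True by (auto simp: shift_def grid_points_def PiE_iff)
  next
    case False
    then show ?thesis using assms(1) by (auto simp: shift_def grid_points_def PiE_def extensional_def)
  qed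
qed

lemma bij_shift: "bij_betw (\<lambda>p. sh p z) G G"
  by (rule bij_betw_byWitness[of _ "\<lambda>p. sh p (\<lambda>k. - z k)"])
    (auto simp: shift_in shift_shift shift_zero)

lemma sum_shift: "(\<Sum>p\<in>G. f (sh p z)) = (\<Sum>p\<in>G. f p)"
  using sum.reindex_bij_betw[OF bij_shift] .

lemma funpow_shift: "p \<in> G \<Longrightarrow> ((\<lambda>p. sh p v) ^^ i) p = sh p (\<lambda>k. int i * v k)"
proof (induction i)
  case 0
  then show ?case by (simp add: shift_zero)
next
  case (Suc i)
  then show ?case by (simp add: shift_shift algebra_simps)
qed

lemma word_system: "w \<noteq> [] \<Longrightarrow> word_system G (\<lambda>p. sh p v) w (\<Prod>k<d. n k)"
proof
  assume "w \<noteq> []" then show "w \<noteq> []" .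
  show "finite G" by (rule finite_grid_points)
  show "bij_betw (\<lambda>p. sh p v) G G" by (rule bij_shift)
  show "0 < (\<Prod>k<d. n k)" using n_pos by (simp add: prod_pos)
  fix x assume x: "x \<in> G"
  have "int (n k) dvd int (\<Prod>k<d. n k) * v k" if "k < d" for k
  proof -
    have "n k dvd (\<Prod>k<d. n k)" using that by (intro dvd_prodI) auto
    then show ?thesis by (intro dvd_mult2) (simp only: int_dvd_int_iff)
  qed
  then show "((\<lambda>p. sh p v) ^^ (\<Prod>k<d. n k)) x = x"
    using funpow_shift[OF x] shift_zero[OF x] by simp
qed

section \<open>Marks and appearances by direction\<close>

definition dir_marks :: "((nat \<Rightarrow> int) \<Rightarrow> 'a) \<Rightarrow> 'a list \<Rightarrow> (nat \<Rightarrow> int) \<Rightarrow> nat" where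
  "dir_marks \<Gamma> w v = card (word_system.marks G (\<lambda>p. sh p v) \<Gamma> w)"

definition dir_word :: "((nat \<Rightarrow> int) \<Rightarrow> 'a) \<Rightarrow> 'a list \<Rightarrow> (nat \<Rightarrow> int) \<Rightarrow> (nat \<Rightarrow> int) \<Rightarrow> 'a list" where
  "dir_word \<Gamma> w v p = map (\<lambda>i. \<Gamma> (sh p (\<lambda>k. int i * v k))) [0..<length w]"

lemma dir_marks_eq:
  assumes "w \<noteq> []"
  shows "dir_marks \<Gamma> w v = card {p \<in> G. dir_word \<Gamma> w v p \<in> {w, rev w}}"
proof -
  interpret word_system G "\<lambda>p. sh p v" \<Gamma> w "\<Prod>k<d. n k" by (rule word_system[OF assms])
  have "word p = dir_word \<Gamma> w v p" if "p \<in> G" for p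
    using that by (simp add: word_def dir_word_def funpow_shift)
  then have "marks = {p \<in> G. dir_word \<Gamma> w v p \<in> {w, rev w}}"
    unfolding marks_def by (intro Collect_cong) auto
  then show ?thesis by (simp add: dir_marks_def)
qed

definition dir_apps :: "((nat \<Rightarrow> int) \<Rightarrow> 'a) \<Rightarrow> 'a list \<Rightarrow> (nat \<Rightarrow> int) \<Rightarrow> nat" where
  "dir_apps \<Gamma> w v = card {p \<in> G. \<forall>i<length w. \<Gamma> (grid_step d n p v i) = w ! i}"

lemma card_appearances: "card (appearances d n \<Gamma> w) = (\<Sum>v\<in>directions d. dir_apps \<Gamma> w v)"
proof -
  let ?S = "SIGMA v:directions d. {p \<in> G. \<forall>i<length w. \<Gamma> (grid_step d n p v i) = w ! i}"
  have "appearances d n \<Gamma> w = prod.swap ` ?S"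
    by (auto simp: appearances_def image_iff)
  then have "card (appearances d n \<Gamma> w) = card ?S"
    by (simp add: card_image)
  also have "\<dots> = (\<Sum>v\<in>directions d. dir_apps \<Gamma> w v)"
    unfolding dir_apps_def by (rule card_SigmaI) (auto simp: finite_directions finite_grid_points)
  finally show ?thesis .
qed

lemma dir_apps_eq: "dir_apps \<Gamma> w v = card {p \<in> G. dir_word \<Gamma> w v p = w}"
proof -
  have "dir_word \<Gamma> w v p = w \<longleftrightarrow> (\<forall>i<length w. \<Gamma> (grid_step d n p v i) = w ! i)" for p
    by (subst list_eq_iff_nth_eq) (simp add: dir_word_def grid_step_eq_shift)
  then show ?thesis by (simp add: dir_apps_def)
qed

text \<open>An occurrence of \<open>rev w\<close> along \<open>v\<close> is one of \<open>w\<close>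
  read from its far end, \<open>length w - 1\<close> steps away.\<close>

lemma dir_apps_neg: "dir_apps \<Gamma> w (neg_dir d v) = card {p \<in> G. dir_word \<Gamma> w v p = rev w}"
proof -
  let ?z = "\<lambda>k. int (length w - 1) * v k"
  have rev: "dir_word \<Gamma> w (neg_dir d v) (sh p ?z) = rev (dir_word \<Gamma> w v p)" for p
  proof (rule nth_equalityI)
    fix i assume "i < length (dir_word \<Gamma> w (neg_dir d v) (sh p ?z))"
    then have i: "i < length w" by (simp add: dir_word_def)
    have "sh (sh p ?z) (\<lambda>k. int i * neg_dir d v k) = sh p (\<lambda>k. int (length w - Suc i) * v k)"
      unfolding shift_shift using i
      by (intro shift_cong) (simp add: neg_dir_def of_nat_diff algebra_simps)
    moreover have "[0..<length w] ! (length w - Suc i) = length w - Suc i"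
      using i by (subst nth_upt) auto
    ultimately show "dir_word \<Gamma> w (neg_dir d v) (sh p ?z) ! i = rev (dir_word \<Gamma> w v p) ! i"
      using i by (simp add: dir_word_def rev_nth)
  qed (simp add: dir_word_def)
  have "bij_betw (\<lambda>p. sh p ?z) {p \<in> G. dir_word \<Gamma> w v p = rev w}
      {p \<in> G. dir_word \<Gamma> w (neg_dir d v) p = w}"
    unfolding bij_betw_def
  proof
    show "inj_on (\<lambda>p. sh p ?z) {p \<in> G. dir_word \<Gamma> w v p = rev w}"
      by (rule inj_on_subset[OF bij_betw_imp_inj_on[OF bij_shift]]) auto
    show "(\<lambda>p. sh p ?z) ` {p \<in> G. dir_word \<Gamma> w v p = rev w} = {p \<in> G. dir_word \<Gamma> w (neg_dir d v) p = w}"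
    proof (intro equalityI subsetI)
      fix q assume q: "q \<in> {p \<in> G. dir_word \<Gamma> w (neg_dir d v) p = w}"
      then have "q \<in> (\<lambda>p. sh p ?z) ` G" using bij_shift[of ?z] by (simp add: bij_betw_def)
      then obtain p where "p \<in> G" "q = sh p ?z" by blast
      moreover from this q have "rev (dir_word \<Gamma> w v p) = w" using rev[of p] by simp
      then have "dir_word \<Gamma> w v p = rev w" by (metis rev_rev_ident)
      ultimately show "q \<in> (\<lambda>p. sh p ?z) ` {p \<in> G. dir_word \<Gamma> w v p = rev w}"
        by blast
    qed (auto simp: rev shift_in simp del: One_nat_def)
  qed
  then show ?thesis by (simp add: dir_apps_eq bij_betw_same_card)
qed

text \<open>A mark in direction \<open>v\<close> is an appearance of \<open>w\<close> from its first
  point along \<open>v\<close> or from its last point along the opposite direction; for a palindrome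
  it is both.\<close>

lemma dir_apps_add_neg:
  assumes "w \<noteq> []"
  shows "dir_apps \<Gamma> w v + dir_apps \<Gamma> w (neg_dir d v) = reading_count w * dir_marks \<Gamma> w v"
proof (cases "w = rev w")
  case True
  then have "dir_apps \<Gamma> w (neg_dir d v) = dir_apps \<Gamma> w v" "dir_marks \<Gamma> w v = dir_apps \<Gamma> w v"
    using dir_apps_neg[of \<Gamma> w v] dir_apps_eq[of \<Gamma> w v] dir_marks_eq[OF assms, of \<Gamma> v] by simp_all
  then show ?thesis using True by (simp add: reading_count_def)
next
  case False
  have "{p \<in> G. dir_word \<Gamma> w v p \<in> {w, rev w}} =
      {p \<in> G. dir_word \<Gamma> w v p = w} \<union> {p \<in> G. dir_word \<Gamma> w v p = rev w}" by auto
  moreover have "{p \<in> G. dir_word \<Gamma> w v p = w} \<inter> {p \<in> G. dir_word \<Gamma> w v p = rev w} = {}"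
    using False by auto
  ultimately show ?thesis
    using False finite_grid_points
    by (simp add: reading_count_def dir_marks_eq[OF assms] dir_apps_neg dir_apps_eq[of \<Gamma> w v] card_Un_disjoint)
qed

lemma card_appearances_marks:
  assumes "w \<noteq> []"
  shows "2 * card (appearances d n \<Gamma> w) = reading_count w * (\<Sum>v\<in>directions d. dir_marks \<Gamma> w v)"
proof -
  have "(\<Sum>v\<in>directions d. dir_apps \<Gamma> w (neg_dir d v)) = (\<Sum>v\<in>directions d. dir_apps \<Gamma> w v)"
    using sum.reindex_bij_betw[OF bij_neg_dir] .
  then have "2 * card (appearances d n \<Gamma> w) =
      (\<Sum>v\<in>directions d. dir_apps \<Gamma> w v + dir_apps \<Gamma> w (neg_dir d v))"
    by (simp add: card_appearances sum.distrib)
  also have "\<dots> = reading_count w * (\<Sum>v\<in>directions d. dir_marks \<Gamma> w v)"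
    by (simp add: dir_apps_add_neg[OF assms] sum_distrib_left)
  finally show ?thesis .
qed

section \<open>Correlations along differences of vectors\<close>

text \<open>After a translation depending on \<open>u\<close> and \<open>u'\<close>, one factor
  involves only \<open>u\<close> and the other only \<open>u'\<close>, so the double sum becomes a
  square.\<close>

lemma autocorrelation:
  fixes f :: "(nat \<Rightarrow> int) \<Rightarrow> real" and U :: "(nat \<Rightarrow> int) set"
  shows "(\<Sum>u\<in>U. \<Sum>u'\<in>U. \<Sum>x\<in>G.
      f (sh x (\<lambda>k. int i * (u' k - u k))) * f (sh x (\<lambda>k. int j * (u' k - u k)))) =
    (\<Sum>y\<in>G. (\<Sum>u\<in>U. f (sh y (\<lambda>k. (int j - int i) * u k)))\<^sup>2)"
proof -
  have "(\<Sum>x\<in>G. f (sh x (\<lambda>k. int i * (u' k - u k))) * f (sh x (\<lambda>k. int j * (u' k - u k)))) =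
      (\<Sum>y\<in>G. f (sh y (\<lambda>k. (int j - int i) * u k)) * f (sh y (\<lambda>k. (int j - int i) * u' k)))" for u u'
    \<comment> \<open>substitute \<open>x = y + j u - i u'\<close>\<close>
    by (subst sum_shift[symmetric, of _ "\<lambda>k. int j * u k - int i * u' k"])
      (simp add: shift_shift algebra_simps)
  then have "(\<Sum>u\<in>U. \<Sum>u'\<in>U. \<Sum>x\<in>G.
      f (sh x (\<lambda>k. int i * (u' k - u k))) * f (sh x (\<lambda>k. int j * (u' k - u k)))) =
    (\<Sum>u\<in>U. \<Sum>u'\<in>U. \<Sum>y\<in>G.
      f (sh y (\<lambda>k. (int j - int i) * u k)) * f (sh y (\<lambda>k. (int j - int i) * u' k)))"
    by simp
  also have "\<dots> = (\<Sum>y\<in>G. \<Sum>u\<in>U. \<Sum>u'\<in>U.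
      f (sh y (\<lambda>k. (int j - int i) * u k)) * f (sh y (\<lambda>k. (int j - int i) * u' k)))"
    by (simp only: sum.swap[of _ G])
  also have "\<dots> = (\<Sum>y\<in>G. (\<Sum>u\<in>U. f (sh y (\<lambda>k. (int j - int i) * u k)))\<^sup>2)"
    by (simp only: power2_eq_square sum_product)
  finally show ?thesis .
qed

text \<open>Expanding the square gives the sums of \<open>autocorrelation\<close> for all
  \<open>i\<close> and \<open>j\<close>. They are nonnegative, and those with \<open>i = j\<close>
  are kept.\<close>

lemma window_moment_lower:
  fixes f :: "(nat \<Rightarrow> int) \<Rightarrow> real" and U :: "(nat \<Rightarrow> int) set"
  shows "real N * (real (card U))\<^sup>2 * (\<Sum>x\<in>G. (f x)\<^sup>2) \<le>
    (\<Sum>u\<in>U. \<Sum>u'\<in>U. \<Sum>x\<in>G. (\<Sum>i<N. f (sh x (\<lambda>k. int i * (u' k - u k))))\<^sup>2)"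
proof -
  define T where "T i j = (\<Sum>y\<in>G. (\<Sum>u\<in>U. f (sh y (\<lambda>k. (int j - int i) * u k)))\<^sup>2)" for i j :: nat
  have T_nonneg: "0 \<le> T i j" for i j by (simp add: T_def sum_nonneg)
  have T_diag: "T i i = (real (card U))\<^sup>2 * (\<Sum>x\<in>G. (f x)\<^sup>2)" for i
    by (simp add: T_def shift_zero power_mult_distrib sum_distrib_left)
  have "(\<Sum>u\<in>U. \<Sum>u'\<in>U. \<Sum>x\<in>G. (\<Sum>i<N. f (sh x (\<lambda>k. int i * (u' k - u k))))\<^sup>2) =
    (\<Sum>u\<in>U. \<Sum>u'\<in>U. \<Sum>x\<in>G. \<Sum>i<N. \<Sum>j<N.
      f (sh x (\<lambda>k. int i * (u' k - u k))) * f (sh x (\<lambda>k. int j * (u' k - u k))))"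
    by (simp only: power2_eq_square sum_product)
  also have "\<dots> = (\<Sum>i<N. \<Sum>j<N. \<Sum>u\<in>U. \<Sum>u'\<in>U. \<Sum>x\<in>G.
      f (sh x (\<lambda>k. int i * (u' k - u k))) * f (sh x (\<lambda>k. int j * (u' k - u k))))"
    by (simp only: sum.swap[of _ "{..<N}" G] sum.swap[of _ "{..<N}" U])
  also have "\<dots> = (\<Sum>i<N. \<Sum>j<N. T i j)"
    by (simp only: autocorrelation T_def)
  finally have "(\<Sum>u\<in>U. \<Sum>u'\<in>U. \<Sum>x\<in>G. (\<Sum>i<N. f (sh x (\<lambda>k. int i * (u' k - u k))))\<^sup>2) =
    (\<Sum>i<N. \<Sum>j<N. T i j)" .
  moreover have "(\<Sum>i<N. T i i) \<le> (\<Sum>i<N. \<Sum>j<N. T i j)"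
    by (intro sum_mono member_le_sum) (auto simp: T_nonneg)
  ultimately show ?thesis by (simp add: T_diag mult.assoc)
qed

end

section \<open>A dense one-dimensional grid\<close>

text \<open>The cyclic grid of length \<open>double_gap w\<close> carrying the sequence of
  \<open>periodic_realization\<close> for an optimal cycle has at least two marks.\<close>

lemma max_concentration_1_ge:
  assumes w: "w \<noteq> []"
  shows "2 * real (reading_count w) / real (double_gap w) \<le> max_concentration 1 w"
proof -
  obtain u v where u: "u \<in> {w, rev w}" and v: "v \<in> {w, rev w}"
    and L: "double_gap w = min_shift u v + min_shift v u"
    by (rule double_gap_attained)
  have ne: "u \<noteq> []" "v \<noteq> []" "length u = length w" "length v = length w" using u v w by auto
  obtain s where s: "\<And>i. i < length w \<Longrightarrow> s (i mod double_gap w) = u ! i"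
    "\<And>i. i < length w \<Longrightarrow> s ((min_shift u v + i) mod double_gap w) = v ! i"
    using periodic_realization[of u v] ne L by metis
  define n where "n = (\<lambda>_::nat. double_gap w)"
  define \<Gamma> where "\<Gamma> p = s (nat (p 0))" for p :: "nat \<Rightarrow> int"
  have L_pos: "0 < double_gap w" by (rule double_gap_pos[OF w])
  interpret grid 1 n by unfold_locales (simp add: n_def L_pos)
  define e where "e = (\<lambda>k\<in>{..<1::nat}. 1::int)"
  define pt where "pt i = (\<lambda>k\<in>{..<1::nat}. int i)" for i
  \<comment> \<open>The two directions differ as integer vectors even if they agree modulo the grid
    length.\<close>
  have e: "e \<in> directions 1" "e \<noteq> neg_dir 1 e"
    by (auto simp: e_def directions_def neg_dir_def fun_eq_iff)
  have pt_in: "pt i \<in> G" if "i < double_gap w" for i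
    using that by (auto simp: pt_def grid_points_def n_def)
  have val: "\<Gamma> (sh (pt i) (\<lambda>k. int j * e k)) = s ((i + j) mod double_gap w)" for i j
    by (simp add: \<Gamma>_def shift_def pt_def e_def n_def nat_mod_distrib flip: of_nat_add of_nat_mod)
  have w0: "dir_word \<Gamma> w e (pt 0) = u"
    using ne by (intro nth_equalityI) (auto simp: dir_word_def val s simp del: One_nat_def)
  have wp: "dir_word \<Gamma> w e (pt (min_shift u v)) = v"
    using ne by (intro nth_equalityI) (auto simp: dir_word_def val s simp del: One_nat_def)
  \<comment> \<open>As \<open>min_shift v u\<close> is positive, the second mark lies strictly
    inside the period and differs from the first even for \<open>u = v\<close>.\<close>
  have p: "0 < min_shift u v" "min_shift u v < double_gap w"
    using min_shift_pos[OF ne(1)] min_shift_pos[OF ne(2)] L by auto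
  have "pt 0 0 \<noteq> pt (min_shift u v) 0" using p by (simp add: pt_def)
  then have "pt 0 \<noteq> pt (min_shift u v)" by metis
  then have "card {pt 0, pt (min_shift u v)} = 2" by simp
  moreover have "{pt 0, pt (min_shift u v)} \<subseteq> {p \<in> G. dir_word \<Gamma> w e p \<in> {w, rev w}}"
    using u v w0 wp pt_in p by auto
  ultimately have "2 \<le> dir_marks \<Gamma> w e"
    unfolding dir_marks_eq[OF w]
    using card_mono[of "{p \<in> G. dir_word \<Gamma> w e p \<in> {w, rev w}}" "{pt 0, pt (min_shift u v)}"]
      finite_grid_points[of 1 n] by simp
  then have "reading_count w * 2 \<le> reading_count w * dir_marks \<Gamma> w e" by (intro mult_left_mono) auto
  also have "\<dots> = (\<Sum>v\<in>{e, neg_dir 1 e}. dir_apps \<Gamma> w v)"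
    unfolding dir_apps_add_neg[OF w, symmetric] using e(2) by (simp del: One_nat_def)
  also have "\<dots> \<le> card (appearances 1 n \<Gamma> w)"
    unfolding card_appearances using e neg_dir_in by (intro sum_mono2) (auto simp: finite_directions)
  finally have "real (reading_count w * 2) \<le> real (card (appearances 1 n \<Gamma> w))" by (simp only: of_nat_le_iff)
  moreover have "card G = double_gap w"
    by (simp add: grid_points_def card_PiE n_def)
  ultimately have "2 * real (reading_count w) / real (double_gap w) \<le> concentration 1 n \<Gamma> w"
    unfolding concentration_def by (simp add: divide_right_mono)
  also have "\<dots> \<le> max_concentration 1 w"
    unfolding max_concentration_def
    by (intro cSup_upper bdd_above_concentrations) (auto simp: concentrations_def n_def L_pos)
  finally show ?thesis .
qed

section \<open>Large dimension\<close>

text \<open>Slantability and the one-dimensional lower bound yield grids whose total deficiency over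
  all directions is small relative to their size. No direction has negative deficiency, so it is
  small in each of them.\<close>

lemma near_optimal_grid:
  assumes w: "w \<noteq> []" and sl: "slantable d w" and \<eta>: "0 < \<eta>"
  obtains n \<Gamma> where "grid d n"
    and "\<And>v. v \<in> directions d \<Longrightarrow> 2 * real (card (grid_points d n))
      - real (double_gap w) * real (grid.dir_marks d n \<Gamma> w v) \<le> \<eta> * real (card (grid_points d n))"
proof -
  let ?D = "3 ^ d - 1 :: real" and ?\<kappa> = "real (reading_count w)" and ?g = "real (double_gap w)"
  have g: "0 < ?g" using double_gap_pos[OF w] by simp
  have \<kappa>: "1 \<le> ?\<kappa>" by (simp add: reading_count_def)
  have D: "real (card (directions d)) = ?D" by (simp add: card_directions of_nat_diff)
  have "?D * ?\<kappa> / ?g = ?D / 2 * (2 * ?\<kappa> / ?g)" by simp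
  also have "\<dots> \<le> ?D / 2 * max_concentration 1 w"
    using max_concentration_1_ge[OF w] by (intro mult_left_mono) auto
  also have "\<dots> = max_concentration d w" using sl by (simp add: slantable_def)
  finally have "?D * ?\<kappa> / ?g \<le> Sup (concentrations d w)" by (simp add: max_concentration_def)
  \<comment> \<open>The margin is scaled so that the deficiencies of all directions sum to at most
    \<open>\<eta> * card G\<close>.\<close>
  moreover have "0 < \<eta> * ?\<kappa> / (2 * ?g)"
    using \<eta> g \<kappa> by (intro divide_pos_pos mult_pos_pos) auto
  ultimately have "?D * ?\<kappa> / ?g - \<eta> * ?\<kappa> / (2 * ?g) < Sup (concentrations d w)" by linarith
  then obtain c where c: "c \<in> concentrations d w" "?D * ?\<kappa> / ?g - \<eta> * ?\<kappa> / (2 * ?g) < c"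
    using less_cSupD[OF concentrations_nonempty] by blast
  then obtain n \<Gamma> where n: "\<forall>k<d. n k > 0" and con: "c = concentration d n \<Gamma> w"
    by (auto simp: concentrations_def)
  interpret grid d n using n by unfold_locales simp
  have G: "0 < real (card G)"
    using shift_in[of undefined undefined] finite_grid_points by (auto simp: card_gt_0_iff)
  let ?m = "\<lambda>v. real (dir_marks \<Gamma> w v)"
  have le: "?g * ?m v \<le> 2 * real (card G)" for v
  proof -
    interpret word_system G "\<lambda>p. sh p v" \<Gamma> w "\<Prod>k<d. n k" by (rule word_system[OF w])
    have "real (double_gap w * card marks) \<le> real (2 * card G)"
      using double_gap_marks_le by (simp only: of_nat_le_iff)
    then show ?thesis by (simp add: dir_marks_def)
  qed
  have "2 * c * real (card G) = real (2 * card (appearances d n \<Gamma> w))"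
    using G by (simp add: con concentration_def)
  also have "\<dots> = ?\<kappa> * (\<Sum>v\<in>directions d. ?m v)"
    by (simp only: card_appearances_marks[OF w]) simp
  finally have eq: "2 * c * real (card G) = ?\<kappa> * (\<Sum>v\<in>directions d. ?m v)" .
  have "?\<kappa> * (2 * ?D - \<eta>) < 2 * c * ?g"
  proof -
    have "?\<kappa> * (2 * ?D - \<eta>) = (?D * ?\<kappa> / ?g - \<eta> * ?\<kappa> / (2 * ?g)) * (2 * ?g)"
      using g by (simp add: field_simps)
    also have "\<dots> < c * (2 * ?g)" using c(2) g by (intro mult_strict_right_mono) auto
    finally show ?thesis by (simp add: algebra_simps)
  qed
  then have "?\<kappa> * (2 * ?D - \<eta>) * real (card G) \<le> 2 * c * ?g * real (card G)"
    using G by simp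
  also have "\<dots> = ?\<kappa> * (?g * (\<Sum>v\<in>directions d. ?m v))"
    using eq by (simp add: algebra_simps)
  finally have "(2 * ?D - \<eta>) * real (card G) \<le> ?g * (\<Sum>v\<in>directions d. ?m v)"
    using \<kappa> by (simp add: mult.assoc)
  then have tot: "(\<Sum>v\<in>directions d. 2 * real (card G) - ?g * ?m v) \<le> \<eta> * real (card G)"
    by (simp add: sum_subtractf D flip: sum_distrib_left) (simp add: algebra_simps)
  have "2 * real (card G) - ?g * ?m v \<le> \<eta> * real (card G)" if "v \<in> directions d" for v
    using member_le_sum[OF that, of "\<lambda>v. 2 * real (card G) - ?g * ?m v"] le finite_directions tot
    by fastforce
  with that[OF grid_axioms] show ?thesis by blast
qed

lemma not_slantable_of_large_dimension:
  assumes w: "is_word w" and d: "1024 * real (length w) ^ 3 \<le> 2 ^ d"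
  shows "\<not> slantable d w"
proof
  assume sl: "slantable d w"
  let ?l = "real (length w)"
  have "card (set w) \<ge> 2" using w by (simp add: is_word_def)
  then obtain a b where ab: "a \<in> set w" "b \<in> set w" "a \<noteq> b"
    by (metis card_le_Suc0_iff_eq List.finite_set not_less_eq_eq numeral_2_eq_2)
  then have w_ne: "w \<noteq> []" by auto
  have l: "1 \<le> ?l" using w_ne by (simp add: Suc_leI)
  define \<chi> where "\<chi> c = (if c = a then 1 else 0 :: real)" for c
  have \<chi>: "0 \<le> \<chi> c" "\<chi> c \<le> 1" for c by (simp_all add: \<chi>_def)
  obtain \<rho> K where \<rho>: "0 \<le> \<rho>" "\<rho> \<le> 1"
    and K: "\<And>u. u \<in> {w, rev w} \<Longrightarrow> \<bar>K u\<bar> \<le> ?l"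
    and edge: "\<And>u v. u \<in> {w, rev w} \<Longrightarrow> v \<in> {w, rev w} \<Longrightarrow>
      min_shift u v + min_shift v u = double_gap w \<Longrightarrow>
      prefix_sum \<chi> u (min_shift u v) - \<rho> * real (min_shift u v) = K v - K u"
    using letter_potential[OF w_ne, of \<chi>] \<chi> by metis
  \<comment> \<open>Two constraints: \<open>2 * N \<le> 2 ^ d\<close>, so that the pairs
    \<open>u = u'\<close> take up at most half of the lower bound, and
    \<open>N > 272 * length w ^ 3\<close> for the final contradiction.\<close>
  define N where "N = 512 * length w ^ 3"
  \<comment> \<open>Makes the error term of \<open>window_second_moment\<close> at most
    \<open>card G\<close>.\<close>
  define \<eta> where "\<eta> = 1 / ((real N)\<^sup>2 * (real N + 1) * (?l + 1))"
  have N: "real N = 512 * ?l ^ 3" by (simp add: N_def)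
  have N1: "1 \<le> real N" using one_le_power[OF l, of 3] by (simp add: N)
  have den: "1 \<le> (real N)\<^sup>2 * (real N + 1) * (?l + 1)"
    using N1 l by (intro mult_ge1_I) auto
  then have \<eta>: "0 < \<eta>" "\<eta> \<le> 1" by (simp_all add: \<eta>_def)
  obtain n and \<Gamma> :: "(nat \<Rightarrow> int) \<Rightarrow> 'a" where gr: "grid d n"
    and near: "\<And>v. v \<in> directions d \<Longrightarrow> 2 * real (card (grid_points d n))
      - real (double_gap w) * real (grid.dir_marks d n \<Gamma> w v) \<le> \<eta> * real (card (grid_points d n))"
    using near_optimal_grid[OF w_ne sl \<eta>(1)] by blast
  interpret grid d n by (rule gr)
  let ?c = "real (card G)"
  have G: "0 < ?c"
    using shift_in[of undefined undefined] finite_grid_points by (auto simp: card_gt_0_iff)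
  define f where "f x = \<chi> (\<Gamma> x) - \<rho>" for x
  define E where "E = (\<Sum>x\<in>G. (f x)\<^sup>2)"
  have upper: "(\<Sum>x\<in>G. (\<Sum>i<N. f (sh x (\<lambda>k. int i * v k)))\<^sup>2) \<le> 17 * ?l\<^sup>2 * ?c"
    if v: "v \<in> directions d" for v
  proof -
    interpret S: word_system G "\<lambda>p. sh p v" \<Gamma> w "\<Prod>k<d. n k" by (rule word_system[OF w_ne])
    have "(\<Sum>x\<in>G. (\<Sum>i<N. f (sh x (\<lambda>k. int i * v k)))\<^sup>2) =
        (\<Sum>x\<in>G. (\<Sum>i<N. \<chi> (\<Gamma> (((\<lambda>p. sh p v) ^^ i) x)) - \<rho>)\<^sup>2)"
      by (intro sum.cong refl) (simp add: funpow_shift f_def)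
    also have "\<dots> \<le> 16 * ?l\<^sup>2 * ?c + (real N)\<^sup>2 * (real N + 1) * (?l + 1)
        * (2 * ?c - real (double_gap w) * real (card S.marks))"
      by (rule S.window_second_moment[OF \<chi> \<rho> K edge])
    also have "\<dots> \<le> 16 * ?l\<^sup>2 * ?c + (real N)\<^sup>2 * (real N + 1) * (?l + 1) * (\<eta> * ?c)"
      using near[OF v] den by (intro add_left_mono mult_left_mono) (auto simp: dir_marks_def)
    also have "\<dots> = 16 * ?l\<^sup>2 * ?c + 1 * ?c"
      using N1 l by (simp add: \<eta>_def)
    also have "\<dots> \<le> 16 * ?l\<^sup>2 * ?c + ?l\<^sup>2 * ?c"
      using one_le_power[OF l, of 2] G by (intro add_left_mono mult_right_mono) auto
    finally show ?thesis by (simp add: algebra_simps)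
  qed
  have "1024 * 1 \<le> 1024 * ?l ^ 3" using one_le_power[OF l, of 3] by simp
  with d have "(2::real) ^ d \<noteq> 2 ^ 0" by simp
  then have d_pos: "0 < d" by (metis gr0I)
  then have "(\<lambda>k\<in>{..<d}. 1) \<in> directions d"
    by (auto simp: directions_def fun_eq_iff)
  then obtain e where e: "e \<in> directions d" by blast
  \<comment> \<open>A deficiency of at most \<open>card G\<close> leaves at least
    \<open>card G / double_gap w\<close> marks in direction \<open>e\<close>, and each letter of
    \<open>w\<close> occurs at least half as often.\<close>
  have letter: "?c \<le> 4 * ?l * real (card {x \<in> G. \<Gamma> x = c})" if c: "c \<in> set w" for c
  proof -
    interpret S: word_system G "\<lambda>p. sh p e" \<Gamma> w "\<Prod>k<d. n k" by (rule word_system[OF w_ne])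
    have "\<eta> * ?c \<le> 1 * ?c" using \<eta> G by (intro mult_right_mono) auto
    then have "?c \<le> real (double_gap w) * real (card S.marks)"
      using near[OF e] by (simp add: dir_marks_def)
    also have "\<dots> \<le> real (2 * length w) * real (2 * card {x \<in> G. \<Gamma> x = c})"
      using double_gap_le_length[OF w_ne] S.card_marks_le_letter[OF c]
      by (intro mult_mono) (simp_all only: of_nat_le_iff of_nat_0_le_iff)
    finally show ?thesis by simp
  qed
  \<comment> \<open>The second moment of \<open>f\<close> cannot be small: on the frequent letters
    \<open>a\<close> and \<open>b\<close> its values are \<open>1 - \<rho>\<close> and
    \<open>- \<rho>\<close>, whose squares sum to at least 1/2.\<close>
  have E: "?c \<le> 8 * ?l * E"
  proof -
    let ?A = "{x \<in> G. \<Gamma> x = a}" and ?B = "{x \<in> G. \<Gamma> x = b}"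
    have "(\<Sum>x\<in>?A \<union> ?B. (f x)\<^sup>2) \<le> E"
      unfolding E_def by (intro sum_mono2) (auto simp: finite_grid_points)
    moreover have "(\<Sum>x\<in>?A \<union> ?B. (f x)\<^sup>2) = (\<Sum>x\<in>?A. (f x)\<^sup>2) + (\<Sum>x\<in>?B. (f x)\<^sup>2)"
      using ab by (intro sum.union_disjoint) (auto simp: finite_grid_points)
    moreover have "(\<Sum>x\<in>?A. (f x)\<^sup>2) = real (card ?A) * (1 - \<rho>)\<^sup>2"
      by (simp add: f_def \<chi>_def)
    moreover have "(\<Sum>x\<in>?B. (f x)\<^sup>2) = real (card ?B) * \<rho>\<^sup>2"
      using ab by (simp add: f_def \<chi>_def)
    ultimately have *: "real (card ?A) * (1 - \<rho>)\<^sup>2 + real (card ?B) * \<rho>\<^sup>2 \<le> E" by simp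
    have "1 / 2 \<le> (1 - \<rho>)\<^sup>2 + \<rho>\<^sup>2"
      using zero_le_power2[of "1 - 2 * \<rho>"] by (simp add: power2_eq_square algebra_simps)
    then have "?c * (1 / 2) \<le> ?c * ((1 - \<rho>)\<^sup>2 + \<rho>\<^sup>2)" using G by (intro mult_left_mono) auto
    also have "\<dots> = ?c * (1 - \<rho>)\<^sup>2 + ?c * \<rho>\<^sup>2" by (simp add: algebra_simps)
    also have "\<dots> \<le> (4 * ?l * real (card ?A)) * (1 - \<rho>)\<^sup>2 + (4 * ?l * real (card ?B)) * \<rho>\<^sup>2"
      using letter ab by (intro add_mono mult_right_mono) auto
    also have "\<dots> = 4 * ?l * (real (card ?A) * (1 - \<rho>)\<^sup>2 + real (card ?B) * \<rho>\<^sup>2)"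
      by (simp add: algebra_simps)
    also have "\<dots> \<le> 4 * ?l * E" using * l by (intro mult_left_mono) auto
    finally show ?thesis by simp
  qed
  \<comment> \<open>The difference of two distinct vertices of this cube is a direction, so
    \<open>upper\<close> applies to all pairs off the diagonal.\<close>
  define U where "U = (\<Pi>\<^sub>E k\<in>{..<d}. {0, 1 :: int})"
  define m where "m = real (card U)"
  define Q where "Q u u' = (\<Sum>x\<in>G. (\<Sum>i<N. f (sh x (\<lambda>k. int i * (u' k - u k))))\<^sup>2)" for u u'
  have fin_U: "finite U" by (auto simp: U_def intro: finite_PiE)
  have m: "m = 2 ^ d" unfolding m_def U_def by (subst card_PiE) (auto simp: numeral_2_eq_2)
  have mN: "2 * real N \<le> m" using d by (simp add: m N)
  have Q_off: "Q u u' \<le> 17 * ?l\<^sup>2 * ?c" if u: "u \<in> U" "u' \<in> U" "u \<noteq> u'" for u u'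
  proof -
    define v where "v = (\<lambda>k\<in>{..<d}. u' k - u k)"
    have "u k \<in> {0, 1}" "u' k \<in> {0, 1}" if "k < d" for k
      using u that by (auto simp: U_def PiE_iff)
    then have "v \<in> (\<Pi>\<^sub>E k\<in>{..<d}. {-1, 0, 1})"
      unfolding v_def by (intro restrict_PiE_iff[THEN iffD2]) fastforce
    moreover have "v \<noteq> (\<lambda>k\<in>{..<d}. 0)"
    proof
      assume "v = (\<lambda>k\<in>{..<d}. 0)"
      then have "u' k = u k" if "k < d" for k
        using that by (auto simp: v_def fun_eq_iff split: if_splits)
      then have "u = u'" using u(1,2) unfolding U_def by (intro PiE_ext) auto
      with u(3) show False by simp
    qed
    ultimately have "v \<in> directions d" by (simp add: directions_def)
    moreover have "sh x (\<lambda>k. int i * (u' k - u k)) = sh x (\<lambda>k. int i * v k)" for x i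
      by (rule shift_cong) (simp add: v_def)
    ultimately show ?thesis using upper by (simp add: Q_def)
  qed
  have Q_diag: "Q u u = (real N)\<^sup>2 * E" for u
    by (simp add: Q_def E_def shift_zero power_mult_distrib sum_distrib_left)
  have E0: "0 \<le> E" by (simp add: E_def sum_nonneg)
  have "real N * m\<^sup>2 * E \<le> (\<Sum>u\<in>U. \<Sum>u'\<in>U. Q u u')"
    unfolding E_def m_def Q_def by (rule window_moment_lower)
  also have "\<dots> \<le> (\<Sum>u\<in>U. (real N)\<^sup>2 * E + m * (17 * ?l\<^sup>2 * ?c))"
  proof (rule sum_mono)
    fix u assume u: "u \<in> U"
    have "(\<Sum>u'\<in>U. Q u u') = Q u u + (\<Sum>u'\<in>U - {u}. Q u u')"
      by (rule sum.remove[OF fin_U u])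
    also have "(\<Sum>u'\<in>U - {u}. Q u u') \<le> (\<Sum>u'\<in>U - {u}. 17 * ?l\<^sup>2 * ?c)"
      using u by (intro sum_mono Q_off) auto
    also have "\<dots> \<le> (\<Sum>u'\<in>U. 17 * ?l\<^sup>2 * ?c)"
      using fin_U by (intro sum_mono2) auto
    also have "\<dots> = m * (17 * ?l\<^sup>2 * ?c)" by (simp add: m_def)
    finally show "(\<Sum>u'\<in>U. Q u u') \<le> (real N)\<^sup>2 * E + m * (17 * ?l\<^sup>2 * ?c)"
      by (simp add: Q_diag)
  qed
  also have "\<dots> = m * (real N * (real N * E)) + m * m * (17 * ?l\<^sup>2 * ?c)"
    by (simp add: m_def algebra_simps power2_eq_square)
  \<comment> \<open>The pairs \<open>u = u'\<close> now take half of the left-hand side and can be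
    subtracted from it.\<close>
  also have "\<dots> \<le> m * (m / 2 * (real N * E)) + m * m * (17 * ?l\<^sup>2 * ?c)"
    using mN m E0 by (intro add_right_mono mult_left_mono mult_right_mono) auto
  finally have "m * m * (real N * E) \<le> m * m * (34 * ?l\<^sup>2 * ?c)"
    by (simp add: power2_eq_square algebra_simps)
  then have "real N * E \<le> 34 * ?l\<^sup>2 * ?c" using m by simp
  also have "\<dots> \<le> 34 * ?l\<^sup>2 * (8 * ?l * E)" using E by (intro mult_left_mono) auto
  also have "\<dots> = 272 * ?l ^ 3 * E" by (simp add: power2_eq_square power3_eq_cube)
  finally have "512 * ?l ^ 3 * E \<le> 272 * ?l ^ 3 * E" by (simp add: N)
  moreover have "0 < E" using E G l by (metis less_le_trans mult_eq_0_iff not_less order_le_less E0)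
  then have "0 < ?l ^ 3 * E" using l by (intro mult_pos_pos zero_less_power) auto
  ultimately show False by linarith
qed

text \<open>A comparison through \<open>2 powr 47 * l ^ 8\<close>, which is 2 raised to the power
  \<open>8 * log 2 l + 47\<close>.\<close>

lemma dimension_bound:
  assumes "0 < l" "8 * log 2 (real l) + 47 \<le> real d"
  shows "1024 * real l ^ 3 \<le> 2 ^ d"
proof -
  have l: "1 \<le> real l" using assms by simp
  have "1024 * real l ^ 3 \<le> 2 powr 47 * real l ^ 8"
    using l by (intro mult_mono power_increasing) auto
  also have "real l ^ 8 = 2 powr (8 * log 2 (real l))"
  proof -
    have "2 powr (8 * log 2 (real l)) = (2 powr log 2 (real l)) powr 8"
      by (simp add: powr_powr mult.commute)
    also have "\<dots> = real l ^ 8" using l by (simp flip: powr_numeral)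
    finally show ?thesis ..
  qed
  also have "2 powr 47 * 2 powr (8 * log 2 (real l)) = 2 powr (8 * log 2 (real l) + 47)"
    by (simp add: powr_add mult.commute)
  also have "\<dots> \<le> 2 powr real d" using assms by (intro powr_mono) auto
  also have "\<dots> = 2 ^ d" by (simp add: powr_realpow)
  finally show ?thesis .
qed

section \<open>Words with a unique first letter\<close>

text \<open>Appearances in one direction occupy disjoint sets of \<open>length w\<close> points: at
  a common point with offsets \<open>i \<le> j\<close>, going back \<open>i\<close> steps puts the
  first letter of one at offset \<open>j - i\<close> of the other, which must be 0.\<close>

lemma (in grid) dir_apps_first_letter_unique:
  assumes uniq: "\<And>i. 0 < i \<Longrightarrow> i < length w \<Longrightarrow> w ! i \<noteq> w ! 0"
  shows "length w * dir_apps \<Gamma> w v \<le> card G"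
proof -
  let ?A = "{p \<in> G. \<forall>i<length w. \<Gamma> (grid_step d n p v i) = w ! i}"
  let ?h = "\<lambda>(p, i). grid_step d n p v i"
  have *: "p = q \<and> i = j"
    if p: "p \<in> ?A" and q: "q \<in> ?A" and j: "j < length w" and ij: "i \<le> j"
      and eq: "grid_step d n p v i = grid_step d n q v j" for p q i j
  proof -
    have "p = sh (grid_step d n p v i) (\<lambda>k. - int i * v k)"
      using p by (simp add: grid_step_eq_shift shift_shift shift_zero)
    also have "\<dots> = grid_step d n q v (j - i)"
      unfolding eq using ij by (simp add: grid_step_eq_shift shift_shift of_nat_diff algebra_simps)
    finally have pq: "p = grid_step d n q v (j - i)" .
    have "0 < length w" using j by linarith
    then have "\<Gamma> (grid_step d n p v 0) = w ! 0" using p by blast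
    then have "\<Gamma> p = w ! 0" using p by (simp add: grid_step_eq_shift shift_zero)
    moreover have "\<Gamma> p = w ! (j - i)" using pq q j by auto
    ultimately have "j - i = 0" using uniq[of "j - i"] j by fastforce
    then have "j = i" using ij by simp
    then show ?thesis using pq q by (simp add: grid_step_eq_shift shift_zero)
  qed
  have "inj_on ?h (?A \<times> {..<length w})"
  proof (rule inj_onI)
    fix x y assume a: "x \<in> ?A \<times> {..<length w}" "y \<in> ?A \<times> {..<length w}" "?h x = ?h y"
    obtain p i q j where xy: "x = (p, i)" "y = (q, j)" by fastforce
    have p: "p \<in> ?A" "i < length w" and q: "q \<in> ?A" "j < length w"
      and eq: "grid_step d n p v i = grid_step d n q v j"
      using a unfolding xy by (simp_all only: mem_Times_iff fst_conv snd_conv lessThan_iff prod.case)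
    show "x = y"
    proof (cases "i \<le> j")
      case True
      then show ?thesis using *[OF p(1) q True eq] xy by blast
    next
      case False
      then have "j \<le> i" by simp
      then show ?thesis using *[OF q(1) p _ eq[symmetric]] xy by blast
    qed
  qed
  moreover have "?h ` (?A \<times> {..<length w}) \<subseteq> G"
    by (auto simp: grid_step_eq_shift shift_in)
  ultimately have "card (?A \<times> {..<length w}) \<le> card G"
    using card_inj_on_le finite_grid_points by blast
  then show ?thesis by (simp add: dir_apps_def card_cartesian_product mult.commute)
qed

lemma max_concentration_le:
  assumes w: "w \<noteq> []" and uniq: "\<And>i. 0 < i \<Longrightarrow> i < length w \<Longrightarrow> w ! i \<noteq> w ! 0"
  shows "max_concentration d w \<le> (3 ^ d - 1) / real (length w)"
  unfolding max_concentration_def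
proof (rule cSup_least[OF concentrations_nonempty])
  fix x assume "x \<in> concentrations d w"
  then obtain n \<Gamma> where n: "\<forall>k<d. n k > 0" and x: "x = concentration d n \<Gamma> w"
    by (auto simp: concentrations_def)
  interpret grid d n using n by unfold_locales simp
  have G: "0 < real (card G)"
    using shift_in[of undefined undefined] finite_grid_points by (auto simp: card_gt_0_iff)
  have "length w * card (appearances d n \<Gamma> w) \<le> (\<Sum>v\<in>directions d. card G)"
    unfolding card_appearances sum_distrib_left
    by (intro sum_mono dir_apps_first_letter_unique uniq)
  then have "real (length w * card (appearances d n \<Gamma> w)) \<le> real ((3 ^ d - 1) * card G)"
    unfolding of_nat_le_iff by (simp add: card_directions)
  then have "real (length w) * real (card (appearances d n \<Gamma> w)) \<le> (3 ^ d - 1) * real (card G)"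
    by (simp add: of_nat_diff)
  then show "x \<le> (3 ^ d - 1) / real (length w)"
    using w G by (simp add: x concentration_def field_simps)
qed

section \<open>A linear form with values prime to the length\<close>

text \<open>On directions this evaluates a binary expansion with digits -1, 0, 1. Such expansions
  are not unique, but 0 has only the trivial one.\<close>

definition binary_form :: "nat \<Rightarrow> (nat \<Rightarrow> int) \<Rightarrow> int" where
  "binary_form d p = (\<Sum>k<d. 2 ^ k * p k)"

lemma binary_form_bound:
  assumes "\<And>k. k < d \<Longrightarrow> v k \<in> {-1, 0, 1}"
  shows "\<bar>binary_form d v\<bar> < 2 ^ d"
  using assms
proof (induction d)
  case 0
  then show ?case by (simp add: binary_form_def)
next
  case (Suc d)
  then have IH: "\<bar>binary_form d v\<bar> < 2 ^ d" and "v d \<in> {-1, 0, 1}" by auto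
  then show ?case by (auto simp: binary_form_def)
qed

text \<open>The lower digits together are smaller in absolute value than the weight of the leading
  one, so the leading digit vanishes; induction settles the rest.\<close>

lemma binary_form_zero:
  assumes "\<And>k. k < d \<Longrightarrow> v k \<in> {-1, 0, 1}" "binary_form d v = 0" "k < d"
  shows "v k = 0"
  using assms
proof (induction d)
  case (Suc d)
  have "\<bar>binary_form d v\<bar> < 2 ^ d" using Suc.prems by (intro binary_form_bound) auto
  moreover have "binary_form d v + 2 ^ d * v d = 0" using Suc.prems by (simp add: binary_form_def)
  moreover have "v d \<in> {-1, 0, 1}" using Suc.prems by auto
  ultimately have "v d = 0" by auto
  then show ?case using Suc by (cases "k = d") (auto simp: binary_form_def)
qed simp

text \<open>The value is nonzero and below \<open>2 ^ d\<close> in absolute value, so its prime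
  factors are too small to divide \<open>l\<close>.\<close>

lemma binary_form_coprime:
  assumes v: "v \<in> directions d" and l: "\<And>p. prime p \<Longrightarrow> p dvd l \<Longrightarrow> 2 ^ d \<le> p"
  shows "coprime (int l) (binary_form d v)"
proof (rule ccontr)
  let ?b = "nat \<bar>binary_form d v\<bar>"
  have vk: "v k \<in> {-1, 0, 1}" if "k < d" for k
    using v that by (auto simp: directions_def PiE_iff)
  have "binary_form d v \<noteq> 0"
  proof
    assume "binary_form d v = 0"
    then have "v k = 0" if "k < d" for k using binary_form_zero vk that by blast
    then have "v = (\<lambda>k\<in>{..<d}. 0)"
      using v by (auto simp: directions_def PiE_def extensional_def fun_eq_iff)
    then show False using v by (simp add: directions_def)
  qed
  then have b: "0 < ?b" "?b < 2 ^ d" using binary_form_bound[of d v] vk by auto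
  assume "\<not> coprime (int l) (binary_form d v)"
  then have "\<not> coprime (int l) (int ?b)" by simp
  then have "gcd l ?b \<noteq> 1" by (metis coprime_iff_gcd_eq_1 coprime_int_iff)
  then obtain p where p: "prime p" "p dvd gcd l ?b" using prime_factor_nat by blast
  then have "p dvd l" "p dvd ?b" using dvd_trans gcd_dvd1 gcd_dvd2 by blast+
  then have "2 ^ d \<le> p" "p \<le> ?b" using l p(1) b(1) dvd_imp_le by blast+
  with b(2) show False by (meson leD order_trans)
qed

lemma binary_form_shift:
  "[binary_form d (shift d (\<lambda>_. l) p z) = binary_form d p + binary_form d z] (mod int l)"
proof -
  have "[(\<Sum>k<d. 2 ^ k * shift d (\<lambda>_. l) p z k) = (\<Sum>k<d. 2 ^ k * (p k + z k))] (mod int l)"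
    by (intro cong_sum cong_mult cong_refl) (simp add: shift_def cong_def)
  then show ?thesis by (simp add: binary_form_def sum.distrib distrib_left)
qed

text \<open>The letter \<open>A\<close> sits on the kernel of the form modulo \<open>l\<close>. From
  a point of the kernel the form takes the values \<open>i * binary_form d v\<close> along
  \<open>v\<close>, which for \<open>i < l\<close> vanish modulo \<open>l\<close> only at
  \<open>i = 0\<close>, so every direction reads the word.\<close>

lemma max_concentration_ge:
  fixes A B :: 'a
  assumes l: "1 < l" and pr: "\<And>p. prime p \<Longrightarrow> p dvd l \<Longrightarrow> 2 ^ d \<le> p"
  shows "(3 ^ d - 1) / real l \<le> max_concentration d (A # replicate (l - 1) B)"
proof -
  let ?w = "A # replicate (l - 1) B"
  \<comment> \<open>All sides equal \<open>l\<close>, so that the form is well defined modulo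
    \<open>l\<close> on the grid.\<close>
  define n where "n = (\<lambda>_::nat. l)"
  define \<Gamma> where "\<Gamma> p = (if int l dvd binary_form d p then A else B)" for p
  interpret grid d n using l by unfold_locales (simp add: n_def)
  define Z where "Z = {p \<in> G. int l dvd binary_form d p}"
  have form_shift: "int l dvd binary_form d (sh p z) \<longleftrightarrow> int l dvd binary_form d p + binary_form d z" for p z
    using binary_form_shift[of d l p z] by (simp add: n_def cong_dvd_iff)
  have G: "0 < real (card G)"
    using shift_in[of undefined undefined] finite_grid_points by (auto simp: card_gt_0_iff)
  have apps: "card Z \<le> dir_apps \<Gamma> ?w v" if v: "v \<in> directions d" for v
    unfolding dir_apps_def
  proof (rule card_mono)
    show "Z \<subseteq> {p \<in> G. \<forall>i<length ?w. \<Gamma> (grid_step d n p v i) = ?w ! i}"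
    proof
      fix p assume "p \<in> Z"
      then have p: "p \<in> G" "int l dvd binary_form d p" by (auto simp: Z_def)
      have "\<Gamma> (grid_step d n p v i) = ?w ! i" if "i < length ?w" for i
      proof -
        have i: "i < l" using that l by simp
        have scale: "binary_form d (\<lambda>k. int i * v k) = int i * binary_form d v"
          by (simp add: binary_form_def sum_distrib_left algebra_simps)
        have "int l dvd int i * binary_form d v \<longleftrightarrow> int l dvd int i"
          using binary_form_coprime[OF v pr] by (simp add: coprime_dvd_mult_left_iff)
        also have "\<dots> \<longleftrightarrow> i = 0"
          using i l by (auto dest: dvd_imp_le)
        finally have "int l dvd binary_form d (grid_step d n p v i) \<longleftrightarrow> i = 0"
          using p(2) by (simp add: grid_step_eq_shift form_shift scale dvd_add_right_iff)
        then show ?thesis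
          using i by (cases i) (auto simp: \<Gamma>_def)
      qed
      with p(1) show "p \<in> {p \<in> G. \<forall>i<length ?w. \<Gamma> (grid_step d n p v i) = ?w ! i}" by blast
    qed
  qed (simp add: finite_grid_points)
  \<comment> \<open>The form sends \<open>c\<close> times the first unit vector to \<open>c\<close>,
    so the translates of \<open>Z\<close> by these vectors with \<open>c < l\<close> cover the
    grid.\<close>
  have Z: "card G \<le> card Z * l" if d: "0 < d"
  proof -
    define e where "e c k = (if k = 0 then c else 0)" for c :: int and k :: nat
    have form_e: "binary_form d (e c) = c" for c
      using d by (simp add: binary_form_def e_def if_distrib cong: if_cong)
    have "G \<subseteq> (\<lambda>(q, c). sh q (e (int c))) ` (Z \<times> {..<l})"
    proof
      fix p assume p: "p \<in> G"
      define c where "c = nat (binary_form d p mod int l)"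
      have c: "int c = binary_form d p mod int l" "c < l" using l by (auto simp: c_def nat_less_iff)
      define q where "q = sh p (e (- int c))"
      have "q \<in> Z" using c by (simp add: Z_def q_def shift_in form_shift form_e minus_mod_eq_mult_div)
      moreover have "p = sh q (e (int c))"
        using p by (simp add: q_def shift_shift e_def shift_zero)
      ultimately show "p \<in> (\<lambda>(q, c). sh q (e (int c))) ` (Z \<times> {..<l})" using c(2) by force
    qed
    moreover have "finite (Z \<times> {..<l})" by (simp add: Z_def finite_grid_points)
    ultimately have "card G \<le> card (Z \<times> {..<l})" by (rule surj_card_le[rotated])
    then show ?thesis by (simp add: card_cartesian_product)
  qed
  have "(3 ^ d - 1) / real l \<le> concentration d n \<Gamma> ?w"
  proof (cases "d = 0")
    case True
    then show ?thesis by (simp add: concentration_def)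
  next
    case False
    have "(3 ^ d - 1) * card G \<le> (\<Sum>v\<in>directions d. card Z * l)"
      using Z False by (simp add: card_directions)
    also have "\<dots> \<le> (\<Sum>v\<in>directions d. dir_apps \<Gamma> ?w v * l)"
      by (intro sum_mono mult_right_mono apps) auto
    also have "\<dots> = card (appearances d n \<Gamma> ?w) * l"
      by (simp add: card_appearances sum_distrib_right)
    finally have "real ((3 ^ d - 1) * card G) \<le> real (card (appearances d n \<Gamma> ?w) * l)"
      by (simp only: of_nat_le_iff)
    then have "(3 ^ d - 1) * real (card G) \<le> real (card (appearances d n \<Gamma> ?w)) * real l"
      by (simp add: of_nat_diff)
    then show ?thesis using G l by (simp add: concentration_def field_simps)
  qed
  also have "\<dots> \<le> max_concentration d ?w"
    unfolding max_concentration_def using l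
    by (intro cSup_upper bdd_above_concentrations) (auto simp: concentrations_def n_def)
  finally show ?thesis .
qed

lemma slantable_first_letter_unique:
  fixes A B :: 'a
  assumes "A \<noteq> B" and l: "1 < l" and pr: "\<And>p. prime p \<Longrightarrow> p dvd l \<Longrightarrow> 2 ^ d \<le> p"
  shows "slantable d (A # replicate (l - 1) B)"
proof -
  let ?w = "A # replicate (l - 1) B"
  have len: "length ?w = l" using l by simp
  have "?w ! i \<noteq> ?w ! 0" if "0 < i" "i < length ?w" for i
    using that \<open>A \<noteq> B\<close> by (cases i) auto
  from max_concentration_le[OF _ this]
  have upper: "max_concentration d ?w \<le> (3 ^ d - 1) / real l" for d
    using len by simp
  have C_d: "max_concentration d ?w = (3 ^ d - 1) / real l"
    using upper max_concentration_ge[OF l pr] by (intro antisym)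
  \<comment> \<open>In dimension one the condition on prime factors reads \<open>2 \<le> p\<close>,
    which holds for every prime.\<close>
  have C_1: "max_concentration 1 ?w = (3 ^ 1 - 1) / real l"
    using upper[of 1] max_concentration_ge[OF l, of 1 A B] prime_ge_2_nat by (intro antisym) auto
  show ?thesis unfolding slantable_def C_d C_1 using l by (simp add: field_simps)
qed

theorem theorem1p5:
  shows "(\<forall>(w :: 'a list) d :: nat.
            is_word w \<and> real d \<ge> 8 * log 2 (real (length w)) + 47 \<longrightarrow> \<not> slantable d w) \<and>
         (\<forall>(A :: 'a) B (l :: nat) d :: nat.
            A \<noteq> B \<and> l > 1 \<and> (\<forall>p. prime p \<and> p dvd l \<longrightarrow> p \<ge> 2 ^ d) \<longrightarrow>
            slantable d (A # replicate (l - 1) B))"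
proof (intro conjI allI impI)
  fix w :: "'a list" and d :: nat
  assume a: "is_word w \<and> real d \<ge> 8 * log 2 (real (length w)) + 47"
  then have "0 < length w" by (auto simp: is_word_def)
  then show "\<not> slantable d w"
    using a by (intro not_slantable_of_large_dimension dimension_bound) auto
next
  fix A B :: 'a and l d :: nat
  assume "A \<noteq> B \<and> l > 1 \<and> (\<forall>p. prime p \<and> p dvd l \<longrightarrow> p \<ge> 2 ^ d)"
  then show "slantable d (A # replicate (l - 1) B)"
    by (intro slantable_first_letter_unique) auto
qed

end
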